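(* Let $\Gamma$ be a charfinite group satisfying the following conditions: (1) the amenable radical of $\Gamma$ is trivial, $Rad(\Gamma)=\{e\}$; (2) every finite dimensional unitary representation of $\Gamma$ has finite image. Then $\Gamma$ has non-factorizable regular character.
   Context: Let $\Gamma$ be a countable discrete group. A character on $\Gamma$ is a function $\phi:\Gamma\to\mathbb{C}$ that is positive definite, conjugation-invariant and normalized ($\phi(e)=1$); it is extremal if it is an extreme point of the convex set of characters. $\Gamma$ has non-factorizable regular character if for any characters $\phi,\psi$ on $\Gamma$ with $\phi(s)\psi(s)=0$ for all $s\neq e$, one has $\phi\equiv\delta_e$ or $\psi\equiv\delta_e$ ($\delta_e$ the Dirac function at $e$). $Rad(\Gamma)$ is the largest amenable normal subgroup of $\Gamma$. $\mathcal{P}(\Gamma)\subset\ell^\infty(\Gamma)$ is the convex set of normalized positive definite functions with the weak$^*$-topology, on which $\Gamma$ acts by conjugation. A character with GNS representation $(\pi,H)$ is called amenable if $\pi\otimes\bar\pi$ weakly contains the trivial representation; von Neumann amenable if moreover $\pi(\Gamma)''$ is an amenable von Neumann algebra; finite if $H$ is finite dimensional. $\Gamma$ is charfinite if: (a) every non-empty $\Gamma$-invariant compact convex subset of $\mathcal{P}(\Gamma)$ contains a fixed point for the conjugation action (i.e. a character); (b) every extremal character is either supported on $Rad(\Gamma)$ or von Neumann amenable; (c) $Rad(\Gamma)$ is finite; (d) $\Gamma$ has a finite number of isomorphism classes of unitary representations in each given finite dimension; (e) every amenable extremal character is finite. *)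

theory Defs
  imports
    "HOL-Analysis.Analysis"
    "HOL-Algebra.Coset"
    "HOL-Library.Function_Algebras"
begin

section \<open>Hilbert spaces and bounded operators\<close>

text \<open>
  The distribution has no complex Hilbert spaces. A Hilbert space is represented here as a closed
  linear subspace of \<open>\<ell>\<^sup>2(I)\<close>, where \<open>I\<close> is an index type. With \<open>I = nat\<close> this
  covers all separable Hilbert spaces up to isomorphism, hence all finite dimensional ones and
  the GNS spaces of countable groups.
\<close>

definition cscale :: "complex \<Rightarrow> ('i \<Rightarrow> complex) \<Rightarrow> 'i \<Rightarrow> complex" where
  "cscale c f = (\<lambda>i. c * f i)"

global_interpretation cfun: vector_space cscale
  by unfold_locales (auto simp: cscale_def fun_eq_iff algebra_simps)

definition ell2 :: "('i \<Rightarrow> complex) set" where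
  "ell2 = {x. (\<lambda>i. (cmod (x i))\<^sup>2) summable_on UNIV}"

definition inner2 :: "('i \<Rightarrow> complex) \<Rightarrow> ('i \<Rightarrow> complex) \<Rightarrow> complex" where
  "inner2 x y = (\<Sum>\<^sub>\<infinity>i. x i * cnj (y i))"

definition norm2 :: "('i \<Rightarrow> complex) \<Rightarrow> real" where
  "norm2 x = sqrt (\<Sum>\<^sub>\<infinity>i. (cmod (x i))\<^sup>2)"

definition closure2 :: "('i \<Rightarrow> complex) set \<Rightarrow> ('i \<Rightarrow> complex) set" where
  "closure2 S = {x \<in> ell2. \<forall>\<epsilon>>0. \<exists>y\<in>S. norm2 (x - y) < \<epsilon>}"

definition hilbert :: "('i \<Rightarrow> complex) set \<Rightarrow> bool" where
  "hilbert H \<longleftrightarrow> cfun.subspace H \<and> H \<subseteq> ell2 \<and> closure2 H = H"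

definition finite_dim :: "('i \<Rightarrow> complex) set \<Rightarrow> bool" where
  "finite_dim H \<longleftrightarrow> (\<exists>B. finite B \<and> H = cfun.span B)"

type_synonym 'i operator = "('i \<Rightarrow> complex) \<Rightarrow> 'i \<Rightarrow> complex"

definition linear_between ::
    "('i \<Rightarrow> complex) set \<Rightarrow> ('j \<Rightarrow> complex) set \<Rightarrow> (('i \<Rightarrow> complex) \<Rightarrow> 'j \<Rightarrow> complex) \<Rightarrow> bool" where
  "linear_between H K T \<longleftrightarrow>
     (\<forall>x\<in>H. T x \<in> K) \<and>
     (\<forall>x\<in>H. \<forall>y\<in>H. T (x + y) = T x + T y) \<and>
     (\<forall>c. \<forall>x\<in>H. T (cscale c x) = cscale c (T x))"

text \<open>
  An operator on \<open>H\<close> takes the value 0 outside \<open>H\<close>. Operators on \<open>H\<close> are thus equal as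
  functions iff they agree on \<open>H\<close>, and sums, scalar multiples and composites of operators are the
  pointwise sums, pointwise multiples and composites of functions.
\<close>

definition bounded_ops :: "('i \<Rightarrow> complex) set \<Rightarrow> 'i operator set" where
  "bounded_ops H =
     {T. linear_between H H T \<and> (\<forall>x. x \<notin> H \<longrightarrow> T x = 0) \<and>
         (\<exists>C. \<forall>x\<in>H. norm2 (T x) \<le> C * norm2 x)}"

definition id_op :: "('i \<Rightarrow> complex) set \<Rightarrow> 'i operator" where
  "id_op H = (\<lambda>x. if x \<in> H then x else 0)"

definition op_norm :: "('i \<Rightarrow> complex) set \<Rightarrow> 'i operator \<Rightarrow> real" where
  "op_norm H T = (SUP x\<in>{x\<in>H. norm2 x \<le> 1}. norm2 (T x))"

definition isometric_iso ::
    "('i \<Rightarrow> complex) set \<Rightarrow> ('j \<Rightarrow> complex) set \<Rightarrow> (('i \<Rightarrow> complex) \<Rightarrow> 'j \<Rightarrow> complex) \<Rightarrow> bool" where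
  "isometric_iso H K V \<longleftrightarrow>
     linear_between H K V \<and> bij_betw V H K \<and>
     (\<forall>x\<in>H. \<forall>y\<in>H. inner2 (V x) (V y) = inner2 x y)"

definition unitary_group :: "('i \<Rightarrow> complex) set \<Rightarrow> 'i operator monoid" where
  "unitary_group H =
     \<lparr>carrier = {U \<in> bounded_ops H. isometric_iso H H U}, monoid.mult = (\<circ>), one = id_op H\<rparr>"

definition commutant :: "('i \<Rightarrow> complex) set \<Rightarrow> 'i operator set \<Rightarrow> 'i operator set" where
  "commutant H S = {T \<in> bounded_ops H. \<forall>R\<in>S. T \<circ> R = R \<circ> T}"

text \<open>A von Neumann algebra \<open>M\<close> on \<open>H\<close> is amenable if there is a projection of norm one from
  \<open>B(H)\<close> onto \<open>M\<close>.\<close>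

definition amenable_vn_algebra :: "('i \<Rightarrow> complex) set \<Rightarrow> 'i operator set \<Rightarrow> bool" where
  "amenable_vn_algebra H M \<longleftrightarrow>
     (\<exists>E. (\<forall>T\<in>bounded_ops H. E T \<in> M) \<and>
          (\<forall>S\<in>bounded_ops H. \<forall>T\<in>bounded_ops H. E (S + T) = E S + E T) \<and>
          (\<forall>c. \<forall>T\<in>bounded_ops H. E (\<lambda>x. cscale c (T x)) = (\<lambda>x. cscale c (E T x))) \<and>
          (\<forall>T\<in>M. E T = T) \<and>
          (\<forall>T\<in>bounded_ops H. op_norm H (E T) \<le> op_norm H T))"


section \<open>Tensor products and conjugates\<close>

definition tensor_vec :: "('i \<Rightarrow> complex) \<Rightarrow> ('j \<Rightarrow> complex) \<Rightarrow> 'i \<times> 'j \<Rightarrow> complex" where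
  "tensor_vec x y = (\<lambda>(i, j). x i * y j)"

definition tensor_space ::
    "('i \<Rightarrow> complex) set \<Rightarrow> ('j \<Rightarrow> complex) set \<Rightarrow> ('i \<times> 'j \<Rightarrow> complex) set" where
  "tensor_space H K = closure2 (cfun.span {tensor_vec x y | x y. x \<in> H \<and> y \<in> K})"

text \<open>Elementary tensors are total, so the operator below is unique; it exists for all bounded
  \<open>S\<close> and \<open>T\<close>.\<close>

definition tensor_op ::
    "('i \<Rightarrow> complex) set \<Rightarrow> ('j \<Rightarrow> complex) set \<Rightarrow> 'i operator \<Rightarrow> 'j operator \<Rightarrow> ('i \<times> 'j) operator" where
  "tensor_op H K S T =
     (THE R. R \<in> bounded_ops (tensor_space H K) \<and>
             (\<forall>x\<in>H. \<forall>y\<in>K. R (tensor_vec x y) = tensor_vec (S x) (T y)))"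

definition conj_vec :: "('i \<Rightarrow> complex) \<Rightarrow> 'i \<Rightarrow> complex" where
  "conj_vec x = (\<lambda>i. cnj (x i))"

definition conj_op :: "'i operator \<Rightarrow> 'i operator" where
  "conj_op T = conj_vec \<circ> T \<circ> conj_vec"


section \<open>Unitary representations\<close>

text \<open>A representation is a pair of a Hilbert space and a map on the group; the values of the map
  outside the carrier of the group are irrelevant.\<close>

type_synonym ('a, 'i) rep = "('i \<Rightarrow> complex) set \<times> ('a \<Rightarrow> 'i operator)"

definition unitary_rep :: "('a, 'b) monoid_scheme \<Rightarrow> ('a, 'i) rep \<Rightarrow> bool" where
  "unitary_rep G = (\<lambda>(H, \<pi>). hilbert H \<and> \<pi> \<in> hom G (unitary_group H))"

definition rep_iso :: "('a, 'b) monoid_scheme \<Rightarrow> ('a, 'i) rep \<Rightarrow> ('a, 'j) rep \<Rightarrow> bool" where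
  "rep_iso G = (\<lambda>(H, \<pi>) (K, \<sigma>).
     \<exists>V. isometric_iso H K V \<and> (\<forall>g\<in>carrier G. \<forall>x\<in>H. V (\<pi> g x) = \<sigma> g (V x)))"

definition unitary_reps_of_dim :: "('a, 'b) monoid_scheme \<Rightarrow> nat \<Rightarrow> ('a, nat) rep set" where
  "unitary_reps_of_dim G n =
     {(H, \<pi>). unitary_rep G (H, \<pi>) \<and> finite_dim H \<and> cfun.dim H = n}"

definition iso_classes_of_dim :: "('a, 'b) monoid_scheme \<Rightarrow> nat \<Rightarrow> ('a, nat) rep set set" where
  "iso_classes_of_dim G n =
     unitary_reps_of_dim G n //
       {(r, s). r \<in> unitary_reps_of_dim G n \<and> s \<in> unitary_reps_of_dim G n \<and> rep_iso G r s}"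

definition tensor_rep :: "('a, 'i) rep \<Rightarrow> ('a, 'j) rep \<Rightarrow> ('a, 'i \<times> 'j) rep" where
  "tensor_rep = (\<lambda>(H, \<pi>) (K, \<sigma>). (tensor_space H K, \<lambda>g. tensor_op H K (\<pi> g) (\<sigma> g)))"

definition conj_rep :: "('a, 'i) rep \<Rightarrow> ('a, 'i) rep" where
  "conj_rep = (\<lambda>(H, \<pi>). (conj_vec ` H, \<lambda>g. conj_op (\<pi> g)))"

definition trivial_rep :: "('a, unit) rep" where
  "trivial_rep = (UNIV, \<lambda>g. id_op UNIV)"

text \<open>Fell's definition of weak containment of \<open>(K, \<sigma>)\<close> in \<open>(H, \<pi>)\<close>, for a discrete group.\<close>

definition weakly_contains :: "('a, 'b) monoid_scheme \<Rightarrow> ('a, 'i) rep \<Rightarrow> ('a, 'j) rep \<Rightarrow> bool" where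
  "weakly_contains G = (\<lambda>(H, \<pi>) (K, \<sigma>).
     \<forall>y\<in>K. \<forall>F \<epsilon>. finite F \<longrightarrow> F \<subseteq> carrier G \<longrightarrow> \<epsilon> > 0 \<longrightarrow>
       (\<exists>xs. set xs \<subseteq> H \<and>
          (\<forall>g\<in>F. cmod (inner2 (\<sigma> g y) y - (\<Sum>x\<leftarrow>xs. inner2 (\<pi> g x) x)) < \<epsilon>)))"


section \<open>Amenable groups and the amenable radical\<close>

definition amenable_group :: "('a, 'b) monoid_scheme \<Rightarrow> bool" where
  "amenable_group G \<longleftrightarrow>
     (\<exists>\<mu> :: 'a set \<Rightarrow> real.
        \<mu> (carrier G) = 1 \<and>
        (\<forall>A \<subseteq> carrier G. \<mu> A \<ge> 0) \<and>
        (\<forall>A \<subseteq> carrier G. \<forall>B \<subseteq> carrier G. A \<inter> B = {} \<longrightarrow> \<mu> (A \<union> B) = \<mu> A + \<mu> B) \<and>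
        (\<forall>g \<in> carrier G. \<forall>A \<subseteq> carrier G. \<mu> (g <#\<^bsub>G\<^esub> A) = \<mu> A))"

text \<open>The greatest element with respect to inclusion; it exists for every discrete group.\<close>

definition amenable_radical :: "('a, 'b) monoid_scheme \<Rightarrow> 'a set" where
  "amenable_radical G = (GREATEST N. N \<lhd> G \<and> amenable_group (G\<lparr>carrier := N\<rparr>))"


section \<open>Positive definite functions and characters\<close>

text \<open>Functions on a group take the value 0 outside its carrier, so that they are equal iff they
  agree on the carrier.\<close>

definition pos_def :: "('a, 'b) monoid_scheme \<Rightarrow> ('a \<Rightarrow> complex) \<Rightarrow> bool" where
  "pos_def G \<phi> \<longleftrightarrow>
     (\<forall>F c. finite F \<longrightarrow> F \<subseteq> carrier G \<longrightarrow>
        (\<Sum>s\<in>F. \<Sum>t\<in>F. c s * cnj (c t) * \<phi> (inv\<^bsub>G\<^esub> t \<otimes>\<^bsub>G\<^esub> s)) \<in> \<real>\<^sub>\<ge>\<^sub>0)"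

definition normalized_pos_def :: "('a, 'b) monoid_scheme \<Rightarrow> ('a \<Rightarrow> complex) set" where
  "normalized_pos_def G =
     {\<phi>. (\<forall>g. g \<notin> carrier G \<longrightarrow> \<phi> g = 0) \<and> pos_def G \<phi> \<and> \<phi> \<one>\<^bsub>G\<^esub> = 1}"

definition conj_action :: "('a, 'b) monoid_scheme \<Rightarrow> 'a \<Rightarrow> ('a \<Rightarrow> complex) \<Rightarrow> 'a \<Rightarrow> complex" where
  "conj_action G s \<phi> =
     (\<lambda>g. if g \<in> carrier G then \<phi> (inv\<^bsub>G\<^esub> s \<otimes>\<^bsub>G\<^esub> g \<otimes>\<^bsub>G\<^esub> s) else 0)"

definition characters :: "('a, 'b) monoid_scheme \<Rightarrow> ('a \<Rightarrow> complex) set" where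
  "characters G =
     {\<phi> \<in> normalized_pos_def G.
        \<forall>g\<in>carrier G. \<forall>h\<in>carrier G. \<phi> (h \<otimes>\<^bsub>G\<^esub> g \<otimes>\<^bsub>G\<^esub> inv\<^bsub>G\<^esub> h) = \<phi> g}"

definition extremal_character :: "('a, 'b) monoid_scheme \<Rightarrow> ('a \<Rightarrow> complex) \<Rightarrow> bool" where
  "extremal_character G \<phi> \<longleftrightarrow>
     \<phi> \<in> characters G \<and>
     (\<forall>\<phi>\<^sub>1\<in>characters G. \<forall>\<phi>\<^sub>2\<in>characters G. \<forall>t::real. 0 < t \<longrightarrow> t < 1 \<longrightarrow>
        \<phi> = cscale (of_real t) \<phi>\<^sub>1 + cscale (of_real (1 - t)) \<phi>\<^sub>2 \<longrightarrow> \<phi>\<^sub>1 = \<phi> \<and> \<phi>\<^sub>2 = \<phi>)"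

definition dirac :: "('a, 'b) monoid_scheme \<Rightarrow> 'a \<Rightarrow> complex" where
  "dirac G = (\<lambda>g. if g = \<one>\<^bsub>G\<^esub> then 1 else 0)"

definition non_factorizable_regular_character :: "('a, 'b) monoid_scheme \<Rightarrow> bool" where
  "non_factorizable_regular_character G \<longleftrightarrow>
     (\<forall>\<phi>\<in>characters G. \<forall>\<psi>\<in>characters G.
        (\<forall>s\<in>carrier G. s \<noteq> \<one>\<^bsub>G\<^esub> \<longrightarrow> \<phi> s * \<psi> s = 0) \<longrightarrow> \<phi> = dirac G \<or> \<psi> = dirac G)"

definition bounded_funs :: "('a, 'b) monoid_scheme \<Rightarrow> ('a \<Rightarrow> complex) set" where
  "bounded_funs G = {f. (\<forall>g. g \<notin> carrier G \<longrightarrow> f g = 0) \<and> bounded (f ` carrier G)}"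

text \<open>The weak* topology on \<open>\<ell>\<^sup>\<infinity>(G)\<close> as the dual of \<open>\<ell>\<^sup>1(G)\<close>.\<close>

definition weak_star_topology :: "('a, 'b) monoid_scheme \<Rightarrow> ('a \<Rightarrow> complex) topology" where
  "weak_star_topology G = topology_generated_by
     {{f \<in> bounded_funs G. (\<Sum>\<^sub>\<infinity>g\<in>carrier G. f g * a g) \<in> U} | a U.
        (\<lambda>g. cmod (a g)) summable_on carrier G \<and> open U}"


section \<open>GNS representations\<close>

text \<open>A GNS triple is unique up to unitary equivalence, and for a countable group it can be realised
  in \<open>\<ell>\<^sup>2(nat)\<close>. It therefore makes no difference that the properties of characters below
  are required of some GNS triple rather than of all of them.\<close>

definition gns_triple ::
    "('a, 'b) monoid_scheme \<Rightarrow> ('a \<Rightarrow> complex) \<Rightarrow> ('a, nat) rep \<Rightarrow> (nat \<Rightarrow> complex) \<Rightarrow> bool" where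
  "gns_triple G \<phi> = (\<lambda>(H, \<pi>) \<xi>.
     unitary_rep G (H, \<pi>) \<and> \<xi> \<in> H \<and>
     closure2 (cfun.span {\<pi> g \<xi> | g. g \<in> carrier G}) = H \<and>
     (\<forall>g\<in>carrier G. inner2 (\<pi> g \<xi>) \<xi> = \<phi> g))"

definition amenable_rep :: "('a, 'b) monoid_scheme \<Rightarrow> ('a, 'i) rep \<Rightarrow> bool" where
  "amenable_rep G r \<longleftrightarrow> weakly_contains G (tensor_rep r (conj_rep r)) trivial_rep"

definition amenable_character :: "('a, 'b) monoid_scheme \<Rightarrow> ('a \<Rightarrow> complex) \<Rightarrow> bool" where
  "amenable_character G \<phi> \<longleftrightarrow>
     \<phi> \<in> characters G \<and> (\<exists>r \<xi>. gns_triple G \<phi> r \<xi> \<and> amenable_rep G r)"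

definition vn_amenable_character :: "('a, 'b) monoid_scheme \<Rightarrow> ('a \<Rightarrow> complex) \<Rightarrow> bool" where
  "vn_amenable_character G \<phi> \<longleftrightarrow>
     \<phi> \<in> characters G \<and>
     (\<exists>H \<pi> \<xi>. gns_triple G \<phi> (H, \<pi>) \<xi> \<and> amenable_rep G (H, \<pi>) \<and>
        amenable_vn_algebra H (commutant H (commutant H (\<pi> ` carrier G))))"

definition finite_character :: "('a, 'b) monoid_scheme \<Rightarrow> ('a \<Rightarrow> complex) \<Rightarrow> bool" where
  "finite_character G \<phi> \<longleftrightarrow>
     \<phi> \<in> characters G \<and> (\<exists>H \<pi> \<xi>. gns_triple G \<phi> (H, \<pi>) \<xi> \<and> finite_dim H)"


section \<open>Charfinite groups\<close>

definition charfinite :: "('a, 'b) monoid_scheme \<Rightarrow> bool" where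
  "charfinite G \<longleftrightarrow>
     (\<forall>C. C \<noteq> {} \<and> C \<subseteq> normalized_pos_def G \<and> compactin (weak_star_topology G) C \<and>
          (\<forall>f\<in>C. \<forall>h\<in>C. \<forall>t::real. 0 \<le> t \<longrightarrow> t \<le> 1 \<longrightarrow>
             cscale (of_real t) f + cscale (of_real (1 - t)) h \<in> C) \<and>
          (\<forall>s\<in>carrier G. \<forall>f\<in>C. conj_action G s f \<in> C) \<longrightarrow>
          (\<exists>f\<in>C. \<forall>s\<in>carrier G. conj_action G s f = f)) \<and>
     (\<forall>\<phi>. extremal_character G \<phi> \<longrightarrow>
        (\<forall>g\<in>carrier G. g \<notin> amenable_radical G \<longrightarrow> \<phi> g = 0) \<or> vn_amenable_character G \<phi>) \<and>
     finite (amenable_radical G) \<and>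
     (\<forall>n. finite (iso_classes_of_dim G n)) \<and>
     (\<forall>\<phi>. extremal_character G \<phi> \<longrightarrow> amenable_character G \<phi> \<longrightarrow> finite_character G \<phi>)"

end

(*
A group with trivial amenable radical has infinite conjugacy classes, so the Dirac function is an
extremal character. Since products of characters are characters (Schur), the characters phi with
phi * psi = dirac then form a closed face of the set of characters, for every character psi. A
strictly convex continuous function attains its maximum on this face at an extremal character,
which is not the Dirac function unless the face is a single point. If phi and psi are non-trivial
factors of the Dirac function, then replacing first phi and then psi in this way makes both of them
extremal and non-trivial; being charfinite, the group has only such characters that are finite, and
their representations have finite image by assumption. An infinite group has an element g other
than the identity that lies in the kernel of both representations, where both characters take the
value 1: a contradiction.

That the amenable radical exists is part of the argument: finitely many normal subgroups with
invariant means have a common invariant mean, obtained by convolution, and compactness gives one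
for arbitrary families.
*)

theory Submission
  imports Defs "HOL-Algebra.Generated_Groups"
begin

section \<open>Integration with respect to finitely additive probabilities\<close>

definition fin_add_prob :: "'a set \<Rightarrow> ('a set \<Rightarrow> real) \<Rightarrow> bool" where
  "fin_add_prob X \<mu> \<longleftrightarrow>
     \<mu> X = 1 \<and> (\<forall>A\<subseteq>X. \<mu> A \<ge> 0) \<and>
     (\<forall>A\<subseteq>X. \<forall>B\<subseteq>X. A \<inter> B = {} \<longrightarrow> \<mu> (A \<union> B) = \<mu> A + \<mu> B)"

lemma fin_add_probD:
  assumes "fin_add_prob X \<mu>"
  shows "\<mu> X = 1" "A \<subseteq> X \<Longrightarrow> \<mu> A \<ge> 0"
    "A \<subseteq> X \<Longrightarrow> B \<subseteq> X \<Longrightarrow> A \<inter> B = {} \<Longrightarrow> \<mu> (A \<union> B) = \<mu> A + \<mu> B"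
  using assms by (auto simp: fin_add_prob_def)

lemma fin_add_prob_empty: "fin_add_prob X \<mu> \<Longrightarrow> \<mu> {} = 0"
  using fin_add_probD(3)[of X \<mu> "{}" "{}"] by simp

lemma fin_add_prob_le_1:
  assumes "fin_add_prob X \<mu>" "A \<subseteq> X"
  shows "\<mu> A \<le> 1"
proof -
  have "A \<union> (X - A) = X" using assms(2) by blast
  then have "\<mu> A + \<mu> (X - A) = 1"
    using fin_add_probD(3)[OF assms, of "X - A"] fin_add_probD(1)[OF assms(1)] by auto
  then show ?thesis using fin_add_probD(2)[OF assms(1), of "X - A"] by auto
qed

lemma fin_add_prob_UN:
  assumes "fin_add_prob X \<mu>" "finite J" "\<And>j. j \<in> J \<Longrightarrow> A j \<subseteq> X" "disjoint_family_on A J"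
  shows "\<mu> (\<Union>j\<in>J. A j) = (\<Sum>j\<in>J. \<mu> (A j))"
  using assms(2-)
proof (induction J rule: finite_induct)
  case empty
  then show ?case by (simp add: fin_add_prob_empty[OF assms(1)])
next
  case (insert i J)
  have "A i \<inter> (\<Union>j\<in>J. A j) = {}"
    using insert.hyps insert.prems(2) by (auto simp: disjoint_family_on_def)
  then have "\<mu> (A i \<union> (\<Union>j\<in>J. A j)) = \<mu> (A i) + \<mu> (\<Union>j\<in>J. A j)"
    using insert.prems(1) by (intro fin_add_probD(3)[OF assms(1)]) auto
  also have "\<mu> (\<Union>j\<in>J. A j) = (\<Sum>j\<in>J. \<mu> (A j))"
    using insert.prems by (intro insert.IH) (auto simp: disjoint_family_on_def)
  finally show ?case using insert.hyps by simp
qed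

definition simple_int :: "'a set \<Rightarrow> ('a set \<Rightarrow> real) \<Rightarrow> ('a \<Rightarrow> real) \<Rightarrow> real" where
  "simple_int X \<mu> s = (\<Sum>v\<in>s ` X. v * \<mu> {x\<in>X. s x = v})"

lemma simple_int_cong:
  assumes "\<And>x. x \<in> X \<Longrightarrow> s x = t x"
  shows "simple_int X \<mu> s = simple_int X \<mu> t"
proof -
  have "s ` X = t ` X" using assms by (rule image_cong[OF refl])
  moreover have "{x\<in>X. s x = v} = {x\<in>X. t x = v}" for v using assms by auto
  ultimately show ?thesis by (simp add: simple_int_def)
qed

lemma simple_int_labels:
  assumes "fin_add_prob X \<mu>" "finite J" "c ` X \<subseteq> J"
  shows "simple_int X \<mu> (\<lambda>x. v (c x)) = (\<Sum>j\<in>J. v j * \<mu> {x\<in>X. c x = j})"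
proof -
  let ?s = "\<lambda>x. v (c x)"
  have fibre: "\<mu> {x\<in>X. v (c x) = u} = (\<Sum>j\<in>{j\<in>J. v j = u}. \<mu> {x\<in>X. c x = j})" for u
  proof -
    have "{x\<in>X. v (c x) = u} = (\<Union>j\<in>{j\<in>J. v j = u}. {x\<in>X. c x = j})"
      using assms(3) by blast
    then show ?thesis
      using assms(2)
      by (simp only:) (intro fin_add_prob_UN[OF assms(1)], auto simp: disjoint_family_on_def)
  qed
  have "simple_int X \<mu> ?s = (\<Sum>u\<in>v ` J. u * \<mu> {x\<in>X. v (c x) = u})"
    unfolding simple_int_def
  proof (rule sum.mono_neutral_left)
    show "\<forall>u\<in>v ` J - ?s ` X. u * \<mu> {x\<in>X. v (c x) = u} = 0"
    proof
      fix u assume "u \<in> v ` J - ?s ` X"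
      then have "{x\<in>X. v (c x) = u} = {}" by blast
      then show "u * \<mu> {x\<in>X. v (c x) = u} = 0"
        by (simp only: fin_add_prob_empty[OF assms(1)] mult_zero_right)
    qed
  qed (use assms in auto)
  also have "\<dots> = (\<Sum>u\<in>v ` J. \<Sum>j\<in>{j\<in>J. v j = u}. v j * \<mu> {x\<in>X. c x = j})"
    unfolding fibre sum_distrib_left by (intro sum.cong refl) auto
  also have "\<dots> = (\<Sum>j\<in>J. v j * \<mu> {x\<in>X. c x = j})"
    using assms(2) by (intro sum.group) auto
  finally show ?thesis .
qed

lemma simple_int_const:
  assumes "fin_add_prob X \<mu>"
  shows "simple_int X \<mu> (\<lambda>_. a) = a"
proof -
  have "(\<lambda>_. ()) ` X \<subseteq> {()}" by auto
  from simple_int_labels[OF assms _ this, of "\<lambda>_. a"] show ?thesis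
    using fin_add_probD(1)[OF assms] by simp
qed

lemma simple_int_mono:
  assumes "fin_add_prob X \<mu>" "finite (s ` X)" "finite (t ` X)" "\<And>x. x \<in> X \<Longrightarrow> s x \<le> t x"
  shows "simple_int X \<mu> s \<le> simple_int X \<mu> t"
proof -
  let ?J = "s ` X \<times> t ` X" and ?c = "\<lambda>x. (s x, t x)"
  have J: "finite ?J" "?c ` X \<subseteq> ?J" using assms by auto
  have "(\<Sum>j\<in>?J. fst j * \<mu> {x\<in>X. ?c x = j}) \<le> (\<Sum>j\<in>?J. snd j * \<mu> {x\<in>X. ?c x = j})"
  proof (rule sum_mono)
    fix j
    show "fst j * \<mu> {x\<in>X. ?c x = j} \<le> snd j * \<mu> {x\<in>X. ?c x = j}"
    proof (cases "{x\<in>X. ?c x = j} = {}")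
      case True
      then show ?thesis by (simp only: fin_add_prob_empty[OF assms(1)] mult_zero_right)
    next
      case False
      then have "fst j \<le> snd j" using assms(4) by force
      then show ?thesis
        by (intro mult_right_mono fin_add_probD(2)[OF assms(1)]) auto
    qed
  qed
  then show ?thesis
    using simple_int_labels[OF assms(1) J, of fst] simple_int_labels[OF assms(1) J, of snd] by simp
qed

lemma simple_int_add:
  assumes "fin_add_prob X \<mu>" "finite (s ` X)" "finite (t ` X)"
  shows "simple_int X \<mu> (\<lambda>x. s x + t x) = simple_int X \<mu> s + simple_int X \<mu> t"
proof -
  let ?J = "s ` X \<times> t ` X" and ?c = "\<lambda>x. (s x, t x)"
  have J: "finite ?J" "?c ` X \<subseteq> ?J" using assms by auto
  note label = simple_int_labels[OF assms(1) J]
  show ?thesis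
    using label[of fst] label[of snd] label[of "\<lambda>j. fst j + snd j"]
    by (simp add: distrib_right sum.distrib)
qed

definition fa_int :: "'a set \<Rightarrow> ('a set \<Rightarrow> real) \<Rightarrow> ('a \<Rightarrow> real) \<Rightarrow> real" where
  "fa_int X \<mu> f = Sup {simple_int X \<mu> s | s. finite (s ` X) \<and> (\<forall>x\<in>X. s x \<le> f x)}"

lemma fa_int_cong:
  assumes "\<And>x. x \<in> X \<Longrightarrow> f x = g x"
  shows "fa_int X \<mu> f = fa_int X \<mu> g"
proof -
  have "(\<forall>x\<in>X. s x \<le> f x) \<longleftrightarrow> (\<forall>x\<in>X. s x \<le> g x)" for s
    using assms by auto
  then show ?thesis by (simp add: fa_int_def)
qed

lemma simple_int_le_fa_int:
  assumes "fin_add_prob X \<mu>" "\<And>x. x \<in> X \<Longrightarrow> f x \<le> B" "finite (s ` X)" "\<And>x. x \<in> X \<Longrightarrow> s x \<le> f x"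
  shows "simple_int X \<mu> s \<le> fa_int X \<mu> f"
  unfolding fa_int_def
proof (rule cSup_upper)
  show "bdd_above {simple_int X \<mu> s | s. finite (s ` X) \<and> (\<forall>x\<in>X. s x \<le> f x)}"
  proof (rule bdd_aboveI[of _ B], clarify)
    fix s :: "'a \<Rightarrow> real" assume s: "finite (s ` X)" "\<forall>x\<in>X. s x \<le> f x"
    have "finite ((\<lambda>_. B) ` X)"
      by (rule finite_subset[of _ "{B}"]) auto
    then have "simple_int X \<mu> s \<le> simple_int X \<mu> (\<lambda>_. B)"
      using s assms(2) by (intro simple_int_mono[OF assms(1)]) force+
    then show "simple_int X \<mu> s \<le> B" by (simp add: simple_int_const[OF assms(1)])
  qed
qed (use assms in auto)

lemma fa_int_le:
  assumes "\<And>x. x \<in> X \<Longrightarrow> 0 \<le> f x"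
    and "\<And>s. finite (s ` X) \<Longrightarrow> (\<And>x. x \<in> X \<Longrightarrow> s x \<le> f x) \<Longrightarrow> simple_int X \<mu> s \<le> K"
  shows "fa_int X \<mu> f \<le> K"
  unfolding fa_int_def
proof (rule cSup_least)
  have "finite ((\<lambda>_. 0 :: real) ` X)"
    by (rule finite_subset[of _ "{0}"]) auto
  then show "{simple_int X \<mu> s | s. finite (s ` X) \<and> (\<forall>x\<in>X. s x \<le> f x)} \<noteq> {}"
    using assms(1) by blast
qed (use assms(2) in blast)

lemma simple_approximation:
  fixes f :: "'a \<Rightarrow> real"
  assumes "\<And>x. x \<in> X \<Longrightarrow> 0 \<le> f x" "\<And>x. x \<in> X \<Longrightarrow> f x \<le> B" "e > 0"
  obtains s where "finite (s ` X)" "\<And>x. x \<in> X \<Longrightarrow> s x \<le> f x" "\<And>x. x \<in> X \<Longrightarrow> f x \<le> s x + e"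
proof
  define s where "s x = of_int \<lfloor>f x / e\<rfloor> * e" for x
  have "s ` X \<subseteq> (\<lambda>k. of_int k * e) ` {0..\<lfloor>B / e\<rfloor>}"
    using assms by (auto simp: s_def intro!: imageI floor_mono divide_right_mono)
  then show "finite (s ` X)" using finite_subset by blast
  show "s x \<le> f x" for x
    using assms(3) mult_right_mono[OF of_int_floor_le[of "f x / e"], of e] by (simp add: s_def)
  show "f x \<le> s x + e" for x
    using assms(3) mult_right_mono[OF real_of_int_floor_add_one_ge[of "f x / e"], of e]
    by (simp add: s_def distrib_right)
qed

lemma fa_int_add:
  assumes \<mu>: "fin_add_prob X \<mu>"
    and f: "\<And>x. x \<in> X \<Longrightarrow> 0 \<le> f x" "\<And>x. x \<in> X \<Longrightarrow> f x \<le> B"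
    and g: "\<And>x. x \<in> X \<Longrightarrow> 0 \<le> g x" "\<And>x. x \<in> X \<Longrightarrow> g x \<le> C"
  shows "fa_int X \<mu> (\<lambda>x. f x + g x) = fa_int X \<mu> f + fa_int X \<mu> g"
proof (rule antisym)
  show "fa_int X \<mu> (\<lambda>x. f x + g x) \<le> fa_int X \<mu> f + fa_int X \<mu> g"
  proof (rule field_le_epsilon)
    fix e :: real assume "e > 0"
    then have e: "e / 2 > 0" by simp
    obtain s where s: "finite (s ` X)" "\<And>x. x \<in> X \<Longrightarrow> s x \<le> f x" "\<And>x. x \<in> X \<Longrightarrow> f x \<le> s x + e / 2"
      using simple_approximation[of X f B, OF f e] by blast
    obtain t where t: "finite (t ` X)" "\<And>x. x \<in> X \<Longrightarrow> t x \<le> g x" "\<And>x. x \<in> X \<Longrightarrow> g x \<le> t x + e / 2"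
      using simple_approximation[of X g C, OF g e] by blast
    have fin: "finite ((\<lambda>x. s x + t x) ` X)"
      by (rule finite_subset[of _ "(\<lambda>(a, b). a + b) ` (s ` X \<times> t ` X)"]) (use s(1) t(1) in auto)
    then have fin': "finite ((\<lambda>x. s x + t x + e) ` X)"
      using finite_imageI[OF fin, of "\<lambda>y. y + e"] by (simp add: image_image)
    have fine: "finite ((\<lambda>_. e) ` X)"
      by (rule finite_subset[of _ "{e}"]) auto
    show "fa_int X \<mu> (\<lambda>x. f x + g x) \<le> fa_int X \<mu> f + fa_int X \<mu> g + e"
    proof (rule fa_int_le)
      fix u assume u: "finite (u ` X)" "\<And>x. x \<in> X \<Longrightarrow> u x \<le> f x + g x"
      have "simple_int X \<mu> u \<le> simple_int X \<mu> (\<lambda>x. s x + t x + e)"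
      proof (rule simple_int_mono[OF \<mu> u(1) fin'])
        fix x assume "x \<in> X"
        then show "u x \<le> s x + t x + e" using u(2)[of x] s(3)[of x] t(3)[of x] by simp
      qed
      also have "\<dots> = simple_int X \<mu> s + simple_int X \<mu> t + e"
        using simple_int_add[OF \<mu> fin fine] simple_int_add[OF \<mu> s(1) t(1)]
        by (simp add: simple_int_const[OF \<mu>])
      also have "\<dots> \<le> fa_int X \<mu> f + fa_int X \<mu> g + e"
        using simple_int_le_fa_int[of X \<mu> f B s, OF \<mu> f(2) s(1,2)]
          simple_int_le_fa_int[of X \<mu> g C t, OF \<mu> g(2) t(1,2)] by simp
      finally show "simple_int X \<mu> u \<le> fa_int X \<mu> f + fa_int X \<mu> g + e" .
    qed (use f g in \<open>simp add: add_nonneg_nonneg\<close>)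
  qed
next
  have *: "simple_int X \<mu> s + simple_int X \<mu> t \<le> fa_int X \<mu> (\<lambda>x. f x + g x)"
    if s: "finite (s ` X)" "\<And>x. x \<in> X \<Longrightarrow> s x \<le> f x"
      and t: "finite (t ` X)" "\<And>x. x \<in> X \<Longrightarrow> t x \<le> g x" for s t
  proof -
    have "finite ((\<lambda>x. s x + t x) ` X)"
      by (rule finite_subset[of _ "(\<lambda>(a, b). a + b) ` (s ` X \<times> t ` X)"]) (use s(1) t(1) in auto)
    then have "simple_int X \<mu> (\<lambda>x. s x + t x) \<le> fa_int X \<mu> (\<lambda>x. f x + g x)"
      using s t f g by (intro simple_int_le_fa_int[OF \<mu>, where B = "B + C"]) (auto intro: add_mono)
    then show ?thesis using simple_int_add[OF \<mu> s(1) t(1)] by simp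
  qed
  have "fa_int X \<mu> f \<le> fa_int X \<mu> (\<lambda>x. f x + g x) - fa_int X \<mu> g"
  proof (rule fa_int_le[OF f(1)])
    fix s assume s: "finite (s ` X)" "\<And>x. x \<in> X \<Longrightarrow> s x \<le> f x"
    have "fa_int X \<mu> g \<le> fa_int X \<mu> (\<lambda>x. f x + g x) - simple_int X \<mu> s"
    proof (rule fa_int_le[OF g(1)])
      fix t assume "finite (t ` X)" "\<And>x. x \<in> X \<Longrightarrow> t x \<le> g x"
      then show "simple_int X \<mu> t \<le> fa_int X \<mu> (\<lambda>x. f x + g x) - simple_int X \<mu> s"
        using *[OF s, of t] by (simp add: algebra_simps)
    qed
    then show "simple_int X \<mu> s \<le> fa_int X \<mu> (\<lambda>x. f x + g x) - fa_int X \<mu> g" by simp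
  qed
  then show "fa_int X \<mu> f + fa_int X \<mu> g \<le> fa_int X \<mu> (\<lambda>x. f x + g x)" by simp
qed

lemma fa_int_const:
  assumes "fin_add_prob X \<mu>" "a \<ge> 0"
  shows "fa_int X \<mu> (\<lambda>_. a) = a"
proof (rule antisym)
  have fin: "finite ((\<lambda>_. a) ` X)"
    by (rule finite_subset[of _ "{a}"]) auto
  show "fa_int X \<mu> (\<lambda>_. a) \<le> a"
  proof (rule fa_int_le[OF assms(2)])
    fix s :: "'a \<Rightarrow> real" assume "finite (s ` X)" "\<And>x. x \<in> X \<Longrightarrow> s x \<le> a"
    then have "simple_int X \<mu> s \<le> simple_int X \<mu> (\<lambda>_. a)"
      by (intro simple_int_mono[OF assms(1) _ fin])
    then show "simple_int X \<mu> s \<le> a" by (simp add: simple_int_const[OF assms(1)])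
  qed
  show "a \<le> fa_int X \<mu> (\<lambda>_. a)"
    using simple_int_le_fa_int[OF assms(1), of "\<lambda>_. a" a "\<lambda>_. a"] fin
    by (simp add: simple_int_const[OF assms(1)])
qed

lemma fa_int_nonneg:
  assumes "fin_add_prob X \<mu>" "\<And>x. x \<in> X \<Longrightarrow> 0 \<le> f x" "\<And>x. x \<in> X \<Longrightarrow> f x \<le> B"
  shows "0 \<le> fa_int X \<mu> f"
proof -
  have "finite ((\<lambda>_. 0 :: real) ` X)"
    by (rule finite_subset[of _ "{0}"]) auto
  then have "simple_int X \<mu> (\<lambda>_. 0) \<le> fa_int X \<mu> f"
    using assms by (intro simple_int_le_fa_int[OF assms(1,3)])
  then show ?thesis by (simp add: simple_int_const[OF assms(1)])
qed

lemma simple_int_bij: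
  assumes \<theta>: "bij_betw \<theta> X X" and inv: "\<And>A. A \<subseteq> X \<Longrightarrow> \<mu> (\<theta> ` A) = \<mu> A"
  shows "simple_int X \<mu> (\<lambda>x. s (\<theta> x)) = simple_int X \<mu> s"
proof -
  have im: "\<theta> ` X = X" using \<theta> by (simp add: bij_betw_def)
  have "\<theta> ` {x\<in>X. s (\<theta> x) = v} = {y\<in>X. s y = v}" for v
    using im by (auto simp: image_iff)
  then have "\<mu> {x\<in>X. s (\<theta> x) = v} = \<mu> {y\<in>X. s y = v}" for v
    using inv[of "{x\<in>X. s (\<theta> x) = v}"] by simp
  moreover have "(\<lambda>x. s (\<theta> x)) ` X = s ` X"
    using image_image[of s \<theta> X] im by simp
  ultimately show ?thesis by (simp add: simple_int_def)
qed

lemma fa_int_bij: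
  assumes \<theta>: "bij_betw \<theta> X X" and inv: "\<And>A. A \<subseteq> X \<Longrightarrow> \<mu> (\<theta> ` A) = \<mu> A"
  shows "fa_int X \<mu> (\<lambda>x. f (\<theta> x)) = fa_int X \<mu> f"
proof -
  have im: "\<theta> ` X = X" using \<theta> by (simp add: bij_betw_def)
  let ?S = "\<lambda>f. {simple_int X \<mu> s | s. finite (s ` X) \<and> (\<forall>x\<in>X. s x \<le> f x)}"
  have "?S f \<subseteq> ?S (\<lambda>x. f (\<theta> x))"
  proof clarify
    fix s :: "'a \<Rightarrow> real" assume s: "finite (s ` X)" "\<forall>x\<in>X. s x \<le> f x"
    have "(\<lambda>x. s (\<theta> x)) ` X = s ` X"
      using image_image[of s \<theta> X] im by simp
    then show "\<exists>t. simple_int X \<mu> s = simple_int X \<mu> t \<and> finite (t ` X) \<and> (\<forall>x\<in>X. t x \<le> f (\<theta> x))"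
      using s im simple_int_bij[of \<theta> X \<mu> s, OF assms] by (intro exI[of _ "\<lambda>x. s (\<theta> x)"]) auto
  qed
  moreover have "?S (\<lambda>x. f (\<theta> x)) \<subseteq> ?S f"
  proof clarify
    fix s :: "'a \<Rightarrow> real" assume s: "finite (s ` X)" "\<forall>x\<in>X. s x \<le> f (\<theta> x)"
    let ?t = "\<lambda>y. s (inv_into X \<theta> y)"
    have inv1: "inv_into X \<theta> (\<theta> x) = x" if "x \<in> X" for x
      using that \<theta> by (simp add: bij_betw_def)
    have "simple_int X \<mu> ?t = simple_int X \<mu> (\<lambda>x. ?t (\<theta> x))"
      using simple_int_bij[of \<theta> X \<mu> ?t, OF assms] by simp
    also have "\<dots> = simple_int X \<mu> s"
      by (rule simple_int_cong) (simp add: inv1)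
    finally have eq: "simple_int X \<mu> s = simple_int X \<mu> ?t" by simp
    have "?t y \<le> f y" "?t y \<in> s ` X" if "y \<in> X" for y
    proof -
      have "y \<in> \<theta> ` X" using that im by simp
      then obtain x where "x \<in> X" "y = \<theta> x" by blast
      then show "?t y \<le> f y" "?t y \<in> s ` X" using s(2) inv1 by auto
    qed
    then show "\<exists>t. simple_int X \<mu> s = simple_int X \<mu> t \<and> finite (t ` X) \<and> (\<forall>x\<in>X. t x \<le> f x)"
      using eq finite_subset[OF _ s(1), of "?t ` X"] by (intro exI[of _ ?t]) auto
  qed
  ultimately show ?thesis by (simp add: fa_int_def)
qed

section \<open>Invariant means and the amenable radical\<close>

lemma compact_PiE_UNIV:
  fixes S :: "'i \<Rightarrow> 'a::topological_space set"
  assumes "\<And>i. compact (S i)"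
  shows "compact (PiE UNIV S)"
proof -
  have "compactin (product_topology (\<lambda>_. euclidean) UNIV) (PiE UNIV S)"
    using assms by (simp add: compactin_PiE)
  then show ?thesis
    by (simp add: euclidean_product_topology)
qed

text \<open>Probabilities are normalised to vanish on sets that are not subsets of \<open>X\<close>: their set is then
  compact in the product topology.\<close>

definition fin_add_probs :: "'a set \<Rightarrow> ('a set \<Rightarrow> real) set" where
  "fin_add_probs X = {\<mu>. fin_add_prob X \<mu> \<and> (\<forall>A. \<not> A \<subseteq> X \<longrightarrow> \<mu> A = 0)}"

lemma closed_fin_add_probs: "closed (fin_add_probs X)"
proof -
  have "closed {\<mu> :: 'a set \<Rightarrow> real. \<mu> A = a}" for A a
    by (intro closed_Collect_eq continuous_on_product_coordinates continuous_on_const)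
  moreover have "closed {\<mu> :: 'a set \<Rightarrow> real. 0 \<le> \<mu> A}" for A
    by (intro closed_Collect_le continuous_on_product_coordinates continuous_on_const)
  moreover have "closed {\<mu> :: 'a set \<Rightarrow> real. \<mu> (A \<union> B) = \<mu> A + \<mu> B}" for A B
    by (intro closed_Collect_eq continuous_on_add continuous_on_product_coordinates)
  moreover have "fin_add_probs X = {\<mu>. \<mu> X = 1} \<inter> (\<Inter>A\<in>Pow X. {\<mu>. 0 \<le> \<mu> A}) \<inter>
      (\<Inter>A\<in>Pow X. \<Inter>B\<in>{B\<in>Pow X. A \<inter> B = {}}. {\<mu>. \<mu> (A \<union> B) = \<mu> A + \<mu> B}) \<inter>
      (\<Inter>A\<in>{A. \<not> A \<subseteq> X}. {\<mu>. \<mu> A = 0})"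
    by (rule Set.set_eqI) (simp add: fin_add_probs_def fin_add_prob_def Pow_def imp_conjL)
  ultimately show ?thesis
    by (simp only:) (intro closed_Int closed_INT ballI; simp)
qed

lemma compact_fin_add_probs: "compact (fin_add_probs X)"
proof -
  have "\<mu> A \<in> {0..1}" if "\<mu> \<in> fin_add_probs X" for \<mu> :: "'a set \<Rightarrow> real" and A
    using that fin_add_probD(2)[of X \<mu> A] fin_add_prob_le_1[of X \<mu> A]
    by (cases "A \<subseteq> X") (auto simp: fin_add_probs_def)
  then have "fin_add_probs X = PiE UNIV (\<lambda>_. {0..1}) \<inter> fin_add_probs X"
    by auto
  also have "compact \<dots>"
    by (intro compact_Int_closed compact_PiE_UNIV closed_fin_add_probs compact_Icc)
  finally show ?thesis .
qed

lemma fin_add_prob_restrict: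
  assumes "fin_add_prob X \<mu>"
  shows "(\<lambda>A. if A \<subseteq> X then \<mu> A else 0) \<in> fin_add_probs X"
  using assms unfolding fin_add_probs_def fin_add_prob_def by simp

definition left_invariant :: "('a, 'b) monoid_scheme \<Rightarrow> 'a set \<Rightarrow> ('a set \<Rightarrow> real) \<Rightarrow> bool" where
  "left_invariant G S \<mu> \<longleftrightarrow> (\<forall>g\<in>S. \<forall>A\<subseteq>carrier G. \<mu> (g <#\<^bsub>G\<^esub> A) = \<mu> A)"

lemma amenable_group_iff:
  "amenable_group G \<longleftrightarrow> (\<exists>\<mu>. fin_add_prob (carrier G) \<mu> \<and> left_invariant G (carrier G) \<mu>)"
  by (simp add: amenable_group_def fin_add_prob_def left_invariant_def)

lemma l_coset_eq_image: "g <#\<^bsub>G\<^esub> A = (\<lambda>x. g \<otimes>\<^bsub>G\<^esub> x) ` A"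
  by (auto simp: l_coset_def)

context group
begin

lemma l_coset_inv_cancel:
  assumes "g \<in> carrier G" "A \<subseteq> carrier G"
  shows "g <# (inv g <# A) = A" "inv g <# (g <# A) = A"
  using assms by (simp_all add: lcos_m_assoc lcos_mult_one)

lemma left_invariant_restrict:
  assumes "left_invariant G S \<mu>" "S \<subseteq> carrier G"
  shows "left_invariant G S (\<lambda>A. if A \<subseteq> carrier G then \<mu> A else 0)"
  unfolding left_invariant_def
proof (intro ballI allI impI)
  fix g A assume "g \<in> S" "A \<subseteq> carrier G"
  moreover from this have "g <# A \<subseteq> carrier G"
    using assms(2) l_coset_subset_G by blast
  ultimately show "(if g <# A \<subseteq> carrier G then \<mu> (g <# A) else 0) = (if A \<subseteq> carrier G then \<mu> A else 0)"
    using assms(1) by (simp add: left_invariant_def)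
qed

lemma closed_left_invariant: "closed {\<mu>. left_invariant G S \<mu>}"
proof -
  have "{\<mu>. left_invariant G S \<mu>} = (\<Inter>g\<in>S. \<Inter>A\<in>Pow (carrier G). {\<mu>. \<mu> (g <# A) = \<mu> A})"
    by (auto simp: left_invariant_def)
  also have "closed \<dots>"
    by (intro closed_INT ballI closed_Collect_eq continuous_on_product_coordinates)
  finally show ?thesis .
qed

text \<open>The convolution \<open>\<mu> * \<nu>\<close> inherits the invariance of both factors, since for \<open>t \<in> T\<close> one has
  \<open>x\<inverse> t A = (x\<inverse> t x) x\<inverse> A\<close> with \<open>x\<inverse> t x \<in> T\<close>.\<close>

lemma ex_invariant_Un:
  assumes \<mu>: "fin_add_prob (carrier G) \<mu>" "left_invariant G S \<mu>" "S \<subseteq> carrier G"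
    and \<nu>: "fin_add_prob (carrier G) \<nu>" "left_invariant G T \<nu>" "T \<subseteq> carrier G"
    and conj: "\<And>x t. x \<in> carrier G \<Longrightarrow> t \<in> T \<Longrightarrow> inv x \<otimes> t \<otimes> x \<in> T"
  shows "\<exists>\<kappa>. fin_add_prob (carrier G) \<kappa> \<and> left_invariant G (S \<union> T) \<kappa>"
proof -
  define F where "F A x = \<nu> (inv x <# A)" for A x
  define \<kappa> where "\<kappa> A = fa_int (carrier G) \<mu> (F A)" for A
  have sub: "inv x <# A \<subseteq> carrier G" if "x \<in> carrier G" "A \<subseteq> carrier G" for x A
    using that l_coset_subset_G by simp
  have F: "0 \<le> F A x" "F A x \<le> 1" if "x \<in> carrier G" "A \<subseteq> carrier G" for x A
    unfolding F_def using sub[OF that] fin_add_probD(2)[OF \<nu>(1)] fin_add_prob_le_1[OF \<nu>(1)] by auto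
  have "fin_add_prob (carrier G) \<kappa>"
    unfolding fin_add_prob_def
  proof (intro conjI allI impI)
    have "inv x <# carrier G = carrier G" if "x \<in> carrier G" for x
      using that by (simp add: l_coset_eq_image surj_const_mult)
    then have "\<kappa> (carrier G) = fa_int (carrier G) \<mu> (\<lambda>_. 1)"
      unfolding \<kappa>_def F_def using fin_add_probD(1)[OF \<nu>(1)] by (intro fa_int_cong) simp
    then show "\<kappa> (carrier G) = 1" by (simp add: fa_int_const[OF \<mu>(1)])
  next
    fix A assume "A \<subseteq> carrier G"
    then show "0 \<le> \<kappa> A"
      unfolding \<kappa>_def using F by (intro fa_int_nonneg[OF \<mu>(1)]) auto
  next
    fix A B assume A: "A \<subseteq> carrier G" and B: "B \<subseteq> carrier G" and disj: "A \<inter> B = {}"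
    have "F (A \<union> B) x = F A x + F B x" if x: "x \<in> carrier G" for x
    proof -
      have "inj_on (\<lambda>y. inv x \<otimes> y) (carrier G)"
        using x by (simp add: inj_on_cmult)
      then have "(inv x <# A) \<inter> (inv x <# B) = {}"
        using inj_on_image_Int[of "\<lambda>y. inv x \<otimes> y" "carrier G" A B] A B disj
        by (simp add: l_coset_eq_image)
      moreover have "inv x <# (A \<union> B) = (inv x <# A) \<union> (inv x <# B)"
        by (simp add: l_coset_eq_image image_Un)
      ultimately show ?thesis
        unfolding F_def using fin_add_probD(3)[OF \<nu>(1) sub[OF x A] sub[OF x B]] by simp
    qed
    then have "\<kappa> (A \<union> B) = fa_int (carrier G) \<mu> (\<lambda>x. F A x + F B x)"
      unfolding \<kappa>_def by (intro fa_int_cong)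
    also have "\<dots> = \<kappa> A + \<kappa> B"
      unfolding \<kappa>_def using F A B by (intro fa_int_add[OF \<mu>(1)]) auto
    finally show "\<kappa> (A \<union> B) = \<kappa> A + \<kappa> B" .
  qed
  moreover have "\<kappa> (g <# A) = \<kappa> A" if g: "g \<in> S" and A: "A \<subseteq> carrier G" for g A
  proof -
    have gG: "g \<in> carrier G" using g \<mu>(3) by blast
    have "\<kappa> (g <# A) = fa_int (carrier G) \<mu> (\<lambda>x. F A (inv g \<otimes> x))"
      unfolding \<kappa>_def
    proof (rule fa_int_cong)
      fix x assume x: "x \<in> carrier G"
      have "inv x <# (g <# A) = inv (inv g \<otimes> x) <# A"
        using x gG A by (simp add: lcos_m_assoc inv_mult_group)
      then show "F (g <# A) x = F A (inv g \<otimes> x)" by (simp add: F_def)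
    qed
    also have "\<dots> = \<kappa> A"
      unfolding \<kappa>_def
    proof (rule fa_int_bij)
      show "bij_betw (\<lambda>x. inv g \<otimes> x) (carrier G) (carrier G)"
        using gG by (simp add: bij_betw_def inj_on_cmult surj_const_mult)
      fix B assume B: "B \<subseteq> carrier G"
      have "\<mu> (g <# (inv g <# B)) = \<mu> (inv g <# B)"
        using \<mu>(2) g sub[OF gG B] by (simp add: left_invariant_def)
      then show "\<mu> ((\<lambda>x. inv g \<otimes> x) ` B) = \<mu> B"
        unfolding l_coset_inv_cancel(1)[OF gG B] by (simp add: l_coset_eq_image)
    qed
    finally show ?thesis .
  qed
  moreover have "\<kappa> (t <# A) = \<kappa> A" if t: "t \<in> T" and A: "A \<subseteq> carrier G" for t A
    unfolding \<kappa>_def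
  proof (rule fa_int_cong)
    fix x assume x: "x \<in> carrier G"
    have tG: "t \<in> carrier G" using t \<nu>(3) by blast
    have "inv x <# (t <# A) = (inv x \<otimes> t \<otimes> x) <# (inv x <# A)"
      using x tG A by (simp add: lcos_m_assoc m_assoc)
    then show "F (t <# A) x = F A x"
      using \<nu>(2) conj[OF x t] sub[OF x A] by (simp add: F_def left_invariant_def)
  qed
  ultimately show ?thesis unfolding left_invariant_def by blast
qed

lemma ex_invariant_Union:
  assumes conj: "\<And>S x s. S \<in> \<S> \<Longrightarrow> x \<in> carrier G \<Longrightarrow> s \<in> S \<Longrightarrow> inv x \<otimes> s \<otimes> x \<in> S"
    and sub: "\<And>S. S \<in> \<S> \<Longrightarrow> S \<subseteq> carrier G"
    and ex: "\<And>S. S \<in> \<S> \<Longrightarrow> \<exists>\<mu>. fin_add_prob (carrier G) \<mu> \<and> left_invariant G S \<mu>"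
  shows "\<exists>\<mu>. fin_add_prob (carrier G) \<mu> \<and> left_invariant G (\<Union>\<S>) \<mu>"
proof -
  have fin: "\<exists>\<mu>. fin_add_prob (carrier G) \<mu> \<and> left_invariant G (\<Union>\<F>) \<mu>" if "finite \<F>" "\<F> \<subseteq> \<S>" for \<F>
    using that
  proof (induction \<F> rule: finite_induct)
    case empty
    have "fin_add_prob (carrier G) (\<lambda>A. of_bool (\<one> \<in> A))"
      by (auto simp: fin_add_prob_def)
    then show ?case by (auto simp: left_invariant_def)
  next
    case (insert S \<F>)
    then obtain \<mu> where \<mu>: "fin_add_prob (carrier G) \<mu>" "left_invariant G (\<Union>\<F>) \<mu>" by blast
    obtain \<nu> where \<nu>: "fin_add_prob (carrier G) \<nu>" "left_invariant G S \<nu>"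
      using ex insert.prems by blast
    have "\<exists>\<kappa>. fin_add_prob (carrier G) \<kappa> \<and> left_invariant G (\<Union>\<F> \<union> S) \<kappa>"
      by (rule ex_invariant_Un[OF \<mu> _ \<nu>]) (use sub conj insert.prems in blast)+
    then show ?case by (simp add: Un_commute)
  qed
  have "fin_add_probs (carrier G) \<inter> (\<Inter>S\<in>\<S>. {\<mu>. left_invariant G S \<mu>}) \<noteq> {}"
  proof (rule compact_imp_fip_image[OF compact_fin_add_probs closed_left_invariant])
    fix \<F> assume \<F>: "finite \<F>" "\<F> \<subseteq> \<S>"
    then obtain \<mu> where \<mu>: "fin_add_prob (carrier G) \<mu>" "left_invariant G (\<Union>\<F>) \<mu>"
      using fin by blast
    let ?\<nu> = "\<lambda>A. if A \<subseteq> carrier G then \<mu> A else 0"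
    have "left_invariant G (\<Union>\<F>) ?\<nu>"
      by (rule left_invariant_restrict[OF \<mu>(2)]) (use sub \<F> in blast)
    then have "?\<nu> \<in> fin_add_probs (carrier G) \<inter> (\<Inter>S\<in>\<F>. {\<mu>. left_invariant G S \<mu>})"
      using fin_add_prob_restrict[OF \<mu>(1)] by (auto simp: left_invariant_def)
    then show "fin_add_probs (carrier G) \<inter> (\<Inter>S\<in>\<F>. {\<mu>. left_invariant G S \<mu>}) \<noteq> {}" by blast
  qed
  then obtain \<mu> where \<mu>: "\<mu> \<in> fin_add_probs (carrier G)" "\<forall>S\<in>\<S>. left_invariant G S \<mu>" by blast
  then have "left_invariant G (\<Union>\<S>) \<mu>" by (auto simp: left_invariant_def)
  then show ?thesis using \<mu>(1) by (auto simp: fin_add_probs_def)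
qed

lemma left_invariant_generate:
  assumes "left_invariant G S \<mu>" "S \<subseteq> carrier G"
  shows "left_invariant G (generate G S) \<mu>"
  unfolding left_invariant_def
proof
  fix g assume "g \<in> generate G S"
  then show "\<forall>A\<subseteq>carrier G. \<mu> (g <# A) = \<mu> A"
  proof induction
    case one
    then show ?case by (simp add: lcos_mult_one)
  next
    case (incl h)
    then show ?case using assms(1) by (simp add: left_invariant_def)
  next
    case (inv h)
    show ?case
    proof (intro allI impI)
      fix A assume A: "A \<subseteq> carrier G"
      have h: "h \<in> carrier G" using inv assms(2) by blast
      have "\<mu> (h <# (inv h <# A)) = \<mu> (inv h <# A)"
        using assms(1) inv h A l_coset_subset_G by (simp add: left_invariant_def)
      then show "\<mu> (inv h <# A) = \<mu> A" by (simp add: l_coset_inv_cancel(1)[OF h A])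
    qed
  next
    case (eng h1 h2)
    show ?case
    proof (intro allI impI)
      fix A assume A: "A \<subseteq> carrier G"
      have h: "h1 \<in> carrier G" "h2 \<in> carrier G"
        using eng generate_incl[OF assms(2)] by auto
      have "(h1 \<otimes> h2) <# A = h1 <# (h2 <# A)"
        using A h by (simp add: lcos_m_assoc)
      then show "\<mu> ((h1 \<otimes> h2) <# A) = \<mu> A"
        using eng.IH A l_coset_subset_G[OF A h(2)] by simp
    qed
  qed
qed

lemma amenable_generate:
  assumes "\<And>S x s. S \<in> \<S> \<Longrightarrow> x \<in> carrier G \<Longrightarrow> s \<in> S \<Longrightarrow> inv x \<otimes> s \<otimes> x \<in> S"
    and sub: "\<And>S. S \<in> \<S> \<Longrightarrow> S \<subseteq> carrier G"
    and "\<And>S. S \<in> \<S> \<Longrightarrow> \<exists>\<mu>. fin_add_prob (carrier G) \<mu> \<and> left_invariant G S \<mu>"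
    and gen: "generate G (\<Union>\<S>) = carrier G"
  shows "amenable_group G"
proof -
  obtain \<mu> where \<mu>: "fin_add_prob (carrier G) \<mu>" "left_invariant G (\<Union>\<S>) \<mu>"
    using ex_invariant_Union[OF assms(1-3)] by blast
  moreover have "left_invariant G (generate G (\<Union>\<S>)) \<mu>"
    by (rule left_invariant_generate[OF \<mu>(2)]) (use sub in blast)
  ultimately show ?thesis unfolding amenable_group_iff gen by blast
qed

text \<open>An invariant mean for the single element \<open>a\<close> is an accumulation point of the uniform
  distributions on \<open>{a\<^sup>0, \<dots>, a\<^sup>n}\<close>.\<close>

lemma ex_invariant_singleton:
  assumes a: "a \<in> carrier G"
  shows "\<exists>\<mu>. fin_add_prob (carrier G) \<mu> \<and> left_invariant G {a} \<mu>"
proof -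
  define K where
    "K n = {\<mu>. \<forall>A\<in>Pow (carrier G). \<bar>\<mu> (a <# A) - \<mu> A\<bar> \<le> 1 / real (Suc n)}" for n
  have closed: "closed (K n)" for n
  proof -
    have "K n = (\<Inter>A\<in>Pow (carrier G). {\<mu>. \<bar>\<mu> (a <# A) - \<mu> A\<bar> \<le> 1 / real (Suc n)})"
      by (auto simp: K_def)
    also have "closed \<dots>"
      by (intro closed_INT ballI closed_Collect_le continuous_on_rabs continuous_on_diff
          continuous_on_product_coordinates continuous_on_const)
    finally show ?thesis .
  qed
  have ex: "\<exists>\<mu>. \<mu> \<in> fin_add_probs (carrier G) \<inter> K n" for n
  proof -
    define \<mu> where "\<mu> A = (\<Sum>i<Suc n. of_bool (a [^] i \<in> A)) / real (Suc n)" for A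
    have aG: "a [^] i \<in> carrier G" for i :: nat using a by simp
    have "fin_add_prob (carrier G) \<mu>"
      unfolding fin_add_prob_def
    proof (intro conjI allI impI)
      show "\<mu> (carrier G) = 1" using aG by (simp add: \<mu>_def del: sum.lessThan_Suc)
      show "0 \<le> \<mu> A" for A by (simp add: \<mu>_def sum_nonneg del: sum.lessThan_Suc)
      fix A B :: "'a set" assume "A \<inter> B = {}"
      then have "(of_bool (a [^] i \<in> A \<union> B) :: real) = of_bool (a [^] i \<in> A) + of_bool (a [^] i \<in> B)"
        for i :: nat by auto
      then show "\<mu> (A \<union> B) = \<mu> A + \<mu> B"
        unfolding \<mu>_def by (simp only: sum.distrib add_divide_distrib)
    qed
    from fin_add_prob_restrict[OF this]
    have "(\<lambda>A. if A \<subseteq> carrier G then \<mu> A else 0) \<in> fin_add_probs (carrier G)" .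
    moreover have "\<bar>\<mu> (a <# A) - \<mu> A\<bar> \<le> 1 / real (Suc n)" if A: "A \<subseteq> carrier G" for A
    proof -
      define f where "f i = (of_bool (a [^] (i :: nat) \<in> a <# A) :: real)" for i
      have "a [^] Suc i \<in> a <# A \<longleftrightarrow> a [^] i \<in> A" for i :: nat
      proof -
        have "a [^] Suc i = a \<otimes> a [^] i" using a by (rule nat_pow_Suc2)
        then show ?thesis using a A by (auto simp: l_coset_def)
      qed
      then have f: "f (Suc i) = of_bool (a [^] i \<in> A)" for i
        by (simp only: f_def)
      have "\<mu> (a <# A) - \<mu> A = ((\<Sum>i<Suc n. f i) - (\<Sum>i<Suc n. f (Suc i))) / real (Suc n)"
        unfolding \<mu>_def f unfolding f_def by (simp only: diff_divide_distrib)
      also have "(\<Sum>i<Suc n. f i) - (\<Sum>i<Suc n. f (Suc i)) = f 0 - f (Suc n)"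
        using sum_lessThan_telescope'[of f "Suc n"] by (simp only: sum_subtractf)
      also have "\<bar>(f 0 - f (Suc n)) / real (Suc n)\<bar> \<le> 1 / real (Suc n)"
        unfolding abs_divide by (intro frac_le) (auto simp: f_def)
      finally show ?thesis .
    qed
    ultimately show ?thesis
      using l_coset_subset_G[OF _ a] by (intro exI[of _ "\<lambda>A. if A \<subseteq> carrier G then \<mu> A else 0"])
        (simp add: K_def)
  qed
  have "fin_add_probs (carrier G) \<inter> (\<Inter>n\<in>UNIV. K n) \<noteq> {}"
  proof (rule compact_imp_fip_image[OF compact_fin_add_probs closed])
    fix N :: "nat set" assume N: "finite N"
    obtain m where m: "\<And>n. n \<in> N \<Longrightarrow> n \<le> m"
      using N unfolding finite_nat_set_iff_bounded_le by blast
    obtain \<mu> where \<mu>: "\<mu> \<in> fin_add_probs (carrier G)" "\<mu> \<in> K m" using ex by blast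
    have "\<mu> \<in> K n" if "n \<in> N" for n
    proof -
      have "1 / real (Suc m) \<le> 1 / real (Suc n)"
        using m[OF that] by (intro frac_le) auto
      then show ?thesis
        using \<mu>(2) unfolding K_def mem_Collect_eq by (meson order_trans)
    qed
    then show "fin_add_probs (carrier G) \<inter> (\<Inter>n\<in>N. K n) \<noteq> {}" using \<mu>(1) by blast
  qed
  then obtain \<mu> where \<mu>: "\<mu> \<in> fin_add_probs (carrier G)" "\<And>n. \<mu> \<in> K n" by blast
  have "\<mu> (a <# A) = \<mu> A" if A: "A \<subseteq> carrier G" for A
  proof (rule ccontr)
    assume "\<mu> (a <# A) \<noteq> \<mu> A"
    then obtain n where "1 / real (Suc n) < \<bar>\<mu> (a <# A) - \<mu> A\<bar>"
      using nat_approx_posE[of "\<bar>\<mu> (a <# A) - \<mu> A\<bar>"] by auto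
    moreover have "\<bar>\<mu> (a <# A) - \<mu> A\<bar> \<le> 1 / real (Suc n)"
      using \<mu>(2)[of n] A unfolding K_def mem_Collect_eq by (meson PowI)
    ultimately show False by simp
  qed
  then show ?thesis using \<mu>(1) by (auto simp: fin_add_probs_def left_invariant_def)
qed

lemma finite_imp_amenable:
  assumes "finite (carrier G)"
  shows "amenable_group G"
proof -
  define \<mu> where "\<mu> A = real (card A) / real (card (carrier G))" for A :: "'a set"
  have pos: "card (carrier G) > 0"
    using assms one_closed by (auto simp: card_gt_0_iff)
  have "fin_add_prob (carrier G) \<mu>"
    unfolding fin_add_prob_def
  proof (intro conjI allI impI)
    show "\<mu> (carrier G) = 1" using pos by (simp add: \<mu>_def)
    show "0 \<le> \<mu> A" for A by (simp add: \<mu>_def)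
    fix A B assume "A \<subseteq> carrier G" "B \<subseteq> carrier G" "A \<inter> B = {}"
    then have "card (A \<union> B) = card A + card B"
      by (intro card_Un_disjoint) (auto intro: finite_subset[OF _ assms])
    then show "\<mu> (A \<union> B) = \<mu> A + \<mu> B" by (simp add: \<mu>_def add_divide_distrib)
  qed
  moreover have "card (g <# A) = card A" if "g \<in> carrier G" "A \<subseteq> carrier G" for g A
    unfolding l_coset_eq_image using that
    by (intro card_image inj_on_subset[OF inj_on_cmult])
  then have "left_invariant G (carrier G) \<mu>"
    by (simp add: left_invariant_def \<mu>_def)
  ultimately show ?thesis unfolding amenable_group_iff by blast
qed

end

lemma (in comm_group) amenable: "amenable_group G"
proof (rule amenable_generate)
  show "generate G (\<Union>((\<lambda>a. {a}) ` carrier G)) = carrier G"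
    using generate_incl[of "carrier G"] generate.incl[of _ "carrier G" G] by auto
  fix S assume "S \<in> (\<lambda>a. {a}) ` carrier G"
  then obtain a where a: "S = {a}" "a \<in> carrier G" by blast
  show "S \<subseteq> carrier G" using a by simp
  show "\<exists>\<mu>. fin_add_prob (carrier G) \<mu> \<and> left_invariant G S \<mu>"
    using a ex_invariant_singleton by simp
  fix x s assume "x \<in> carrier G" "s \<in> S"
  then show "inv x \<otimes> s \<otimes> x \<in> S"
    using a by (simp add: m_comm[of "inv x" a] m_assoc)
qed

lemma (in group) normal_conj_closed:
  assumes "N \<lhd> G" "x \<in> carrier G" "n \<in> N"
  shows "x \<otimes> n \<otimes> inv x \<in> N" "inv x \<otimes> n \<otimes> x \<in> N"
  using assms by (simp_all add: normal.inv_op_closed1 normal.inv_op_closed2)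

lemma (in group) greatest_amenable_normal:
  defines "\<N> \<equiv> {N. N \<lhd> G \<and> amenable_group (G\<lparr>carrier := N\<rparr>)}"
  shows "generate G (\<Union>\<N>) \<in> \<N>"
proof -
  let ?R = "generate G (\<Union>\<N>)" and ?H = "G\<lparr>carrier := generate G (\<Union>\<N>)\<rparr>"
  have sub: "\<Union>\<N> \<subseteq> carrier G"
    using normal_imp_subgroup subgroup.subset by (fastforce simp: \<N>_def)
  have R: "subgroup ?R G" by (rule generate_is_subgroup[OF sub])
  then have RG: "?R \<subseteq> carrier G" by (rule subgroup.subset)
  interpret H: group ?H by (rule subgroup_imp_group[OF R])
  have NR: "N \<subseteq> ?R" if "N \<in> \<N>" for N
    using that by (auto intro: generate.incl)
  have normal: "?R \<lhd> G"
  proof (rule normal_generateI[OF sub])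
    fix h g assume "h \<in> \<Union>\<N>" "g \<in> carrier G"
    then show "g \<otimes> h \<otimes> inv g \<in> \<Union>\<N>"
      using normal_conj_closed(1) unfolding \<N>_def by blast
  qed
  have "amenable_group ?H"
  proof (rule H.amenable_generate)
    show "generate ?H (\<Union>\<N>) = carrier ?H"
      using generate_consistent[OF _ R, of "\<Union>\<N>"] NR by auto
    fix N assume N: "N \<in> \<N>"
    then have NG: "N \<lhd> G" "subgroup N G"
      using normal_imp_subgroup by (auto simp: \<N>_def)
    show "N \<subseteq> carrier ?H" using NR[OF N] by simp
    show "inv\<^bsub>?H\<^esub> x \<otimes>\<^bsub>?H\<^esub> s \<otimes>\<^bsub>?H\<^esub> x \<in> N" if "x \<in> carrier ?H" "s \<in> N" for x s
      using that normal_conj_closed(2)[OF NG(1)] RG by (auto simp: m_inv_consistent[OF R])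
    obtain \<mu> where \<mu>: "fin_add_prob N \<mu>" "left_invariant (G\<lparr>carrier := N\<rparr>) N \<mu>"
      using N by (auto simp: \<N>_def amenable_group_iff)
    let ?\<nu> = "\<lambda>A. \<mu> (A \<inter> N)"
    have "fin_add_prob (carrier ?H) ?\<nu>"
      unfolding fin_add_prob_def
    proof (intro conjI allI impI)
      have "carrier ?H \<inter> N = N" using NR[OF N] by auto
      then show "?\<nu> (carrier ?H) = 1" using fin_add_probD(1)[OF \<mu>(1)] by (simp only:)
      show "0 \<le> ?\<nu> A" for A by (rule fin_add_probD(2)[OF \<mu>(1)]) simp
      fix A B :: "'a set" assume "A \<inter> B = {}"
      then show "?\<nu> (A \<union> B) = ?\<nu> A + ?\<nu> B"
        unfolding Int_Un_distrib2 by (intro fin_add_probD(3)[OF \<mu>(1)]) auto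
    qed
    moreover have "left_invariant ?H N ?\<nu>"
      unfolding left_invariant_def
    proof (intro ballI allI impI)
      fix g A assume g: "g \<in> N" and A: "A \<subseteq> carrier ?H"
      have AG: "A \<subseteq> carrier G" using A RG by auto
      have "g \<otimes> x \<in> N \<longleftrightarrow> x \<in> N" if "x \<in> A" for x
      proof
        assume "g \<otimes> x \<in> N"
        then have "inv g \<otimes> (g \<otimes> x) \<in> N"
          using g NG(2) by (simp add: subgroup.m_closed subgroup.m_inv_closed)
        then show "x \<in> N"
          using that AG subgroup.mem_carrier[OF NG(2) g] by (auto simp: m_assoc[symmetric])
      qed (use g NG(2) in \<open>simp add: subgroup.m_closed\<close>)
      then have "(g <#\<^bsub>?H\<^esub> A) \<inter> N = g <#\<^bsub>G\<lparr>carrier := N\<rparr>\<^esub> (A \<inter> N)"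
        by (auto simp: l_coset_def)
      then show "\<mu> ((g <#\<^bsub>?H\<^esub> A) \<inter> N) = \<mu> (A \<inter> N)"
        using \<mu>(2) g by (simp add: left_invariant_def)
    qed
    ultimately show "\<exists>\<mu>. fin_add_prob (carrier ?H) \<mu> \<and> left_invariant ?H N \<mu>" by blast
  qed
  then show ?thesis using normal by (simp add: \<N>_def)
qed

lemma (in group) amenable_normal_le_radical:
  assumes "N \<lhd> G" "amenable_group (G\<lparr>carrier := N\<rparr>)"
  shows "N \<subseteq> amenable_radical G"
proof -
  let ?\<N> = "{N. N \<lhd> G \<and> amenable_group (G\<lparr>carrier := N\<rparr>)}"
  have le: "M \<subseteq> generate G (\<Union>?\<N>)" if "M \<in> ?\<N>" for M
    using that by (auto intro: generate.incl)
  have "amenable_radical G = generate G (\<Union>?\<N>)"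
    unfolding amenable_radical_def
    by (rule Greatest_equality) (use greatest_amenable_normal le in auto)
  then show ?thesis using le assms by simp
qed

section \<open>Positive semidefinite kernels and characters\<close>

definition psd_on :: "'a set \<Rightarrow> ('a \<Rightarrow> 'a \<Rightarrow> complex) \<Rightarrow> bool" where
  "psd_on F k \<longleftrightarrow> (\<forall>c. (\<Sum>s\<in>F. \<Sum>t\<in>F. c s * cnj (c t) * k s t) \<in> \<real>\<^sub>\<ge>\<^sub>0)"

lemma psd_onD: "psd_on F k \<Longrightarrow> (\<Sum>s\<in>F. \<Sum>t\<in>F. c s * cnj (c t) * k s t) \<in> \<real>\<^sub>\<ge>\<^sub>0"
  by (simp add: psd_on_def)

lemma pos_def_iff_psd_on:
  "pos_def G \<phi> \<longleftrightarrow>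
     (\<forall>F. finite F \<longrightarrow> F \<subseteq> carrier G \<longrightarrow> psd_on F (\<lambda>s t. \<phi> (inv\<^bsub>G\<^esub> t \<otimes>\<^bsub>G\<^esub> s)))"
  by (auto simp: pos_def_def psd_on_def)

lemma psd_on_subset:
  assumes "psd_on F k" "finite F" "E \<subseteq> F"
  shows "psd_on E k"
  unfolding psd_on_def
proof
  fix c :: "'a \<Rightarrow> complex"
  define d where "d s = (if s \<in> E then c s else 0)" for s
  have "(\<Sum>s\<in>F. \<Sum>t\<in>F. d s * cnj (d t) * k s t) = (\<Sum>s\<in>E. \<Sum>t\<in>F. d s * cnj (d t) * k s t)"
    using assms by (intro sum.mono_neutral_right) (auto simp: d_def)
  also have "\<dots> = (\<Sum>s\<in>E. \<Sum>t\<in>E. d s * cnj (d t) * k s t)"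
    using assms by (intro sum.cong refl sum.mono_neutral_right) (auto simp: d_def)
  also have "\<dots> = (\<Sum>s\<in>E. \<Sum>t\<in>E. c s * cnj (c t) * k s t)"
    by (intro sum.cong refl) (auto simp: d_def)
  finally show "(\<Sum>s\<in>E. \<Sum>t\<in>E. c s * cnj (c t) * k s t) \<in> \<real>\<^sub>\<ge>\<^sub>0"
    using psd_onD[OF assms(1), of d] by simp
qed

lemma psd_on_diag:
  assumes "psd_on F k" "finite F" "s \<in> F"
  shows "k s s \<in> \<real>\<^sub>\<ge>\<^sub>0"
  using psd_onD[OF psd_on_subset[OF assms(1,2), of "{s}"], of "\<lambda>_. 1"] assms(3) by simp

lemma psd_on_pair:
  assumes "psd_on F k" "finite F" "s \<in> F" "t \<in> F" "s \<noteq> t"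
  shows "a * cnj a * k s s + a * cnj b * k s t + b * cnj a * k t s + b * cnj b * k t t \<in> \<real>\<^sub>\<ge>\<^sub>0"
  using psd_onD[OF psd_on_subset[OF assms(1,2), of "{s,t}"], of "\<lambda>x. if x = s then a else b"] assms(3-)
  by (simp add: add.assoc)

lemma psd_on_hermitian:
  assumes "psd_on F k" "finite F" "s \<in> F" "t \<in> F"
  shows "k t s = cnj (k s t)"
proof (cases "s = t")
  case True
  then show ?thesis using psd_on_diag[OF assms(1-3)] by (auto simp: nonneg_Reals_def)
next
  case False
  have "Im (k s s) = 0" "Im (k t t) = 0"
    using psd_on_diag[OF assms(1-3)] psd_on_diag[OF assms(1,2,4)] by (auto simp: complex_nonneg_Reals_iff)
  with psd_on_pair[OF assms False, of 1 1] psd_on_pair[OF assms False, of 1 \<i>]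
  show ?thesis by (auto simp: complex_nonneg_Reals_iff complex_eq_iff)
qed

lemma psd_on_diag_zero:
  assumes "psd_on F k" "finite F" "s \<in> F" "t \<in> F" "k t t = 0"
  shows "k s t = 0"
proof (cases "s = t")
  case False
  have h: "k t s = cnj (k s t)"
    using psd_on_hermitian[OF assms(1-4)] .
  have "2 * real n * (cmod (k s t))\<^sup>2 \<le> Re (k s s)" for n
    using psd_on_pair[OF assms(1-4) False, of 1 "- of_nat n * k s t"] assms(5) unfolding h
    unfolding cmod_power2 by (simp add: complex_nonneg_Reals_iff algebra_simps power2_eq_square)
  then have "real n * (2 * (cmod (k s t))\<^sup>2) \<le> Re (k s s)" for n
    by (metis mult.assoc mult.commute)
  then have "\<not> 0 < 2 * (cmod (k s t))\<^sup>2"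
    by (metis reals_Archimedean3 not_le)
  then show ?thesis by simp
qed (use assms in auto)

lemma psd_on_gram:
  assumes "finite F" "psd_on F k"
  shows "\<exists>v. \<forall>s\<in>F. \<forall>t\<in>F. k s t = (\<Sum>p\<in>F. v p s * cnj (v p t))"
  using assms
proof (induction F arbitrary: k rule: finite_induct)
  case empty
  then show ?case by simp
next
  case (insert p F)
  define d where "d = Re (k p p)"
  have kpp: "k p p = of_real d" "d \<ge> 0"
    using psd_on_diag[OF insert.prems, of p] insert.hyps
    by (auto simp: d_def complex_nonneg_Reals_iff complex_eq_iff)
  have herm: "k t s = cnj (k s t)" if "s \<in> insert p F" "t \<in> insert p F" for s t
    by (rule psd_on_hermitian[OF insert.prems _ that]) (use insert.hyps in simp)
  \<comment> \<open>The Schur complement of the entry at \<open>p\<close>; if that entry is 0, then so is its row, and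
    \<open>x / 0 = 0\<close> makes the formulas below correct in this case too.\<close>
  define k' where "k' s t = k s t - k s p * k p t / of_real d" for s t
  have zero: "k s p = 0" if "d = 0" "s \<in> insert p F" for s
    by (rule psd_on_diag_zero[OF insert.prems _ that(2)]) (use insert.hyps kpp that in simp_all)
  have "psd_on F k'"
    unfolding psd_on_def
  proof
    fix c :: "'a \<Rightarrow> complex"
    define A where "A = (\<Sum>s\<in>F. c s * k s p)"
    define e where "e = c(p := - A / of_real d)"
    have e: "e s = c s" if "s \<in> F" for s
      using that insert.hyps by (auto simp: e_def)
    have ep: "e p = - A / of_real d" by (simp add: e_def)
    have A': "(\<Sum>t\<in>F. cnj (c t) * k p t) = cnj A"
      unfolding A_def cnj_sum by (intro sum.cong refl) (simp add: herm[of p])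
    have A0: "A = 0" if "d = 0"
      unfolding A_def using zero that by (intro sum.neutral) auto
    have "(\<Sum>s\<in>insert p F. \<Sum>t\<in>insert p F. e s * cnj (e t) * k s t)
       = e p * cnj (e p) * of_real d + e p * (\<Sum>t\<in>F. cnj (c t) * k p t)
         + (cnj (e p) * A + (\<Sum>s\<in>F. \<Sum>t\<in>F. c s * cnj (c t) * k s t))"
      using insert.hyps
      by (simp add: sum.distrib e kpp A_def sum_distrib_left mult_ac)
    also have "\<dots> = (\<Sum>s\<in>F. \<Sum>t\<in>F. c s * cnj (c t) * k s t) - A * cnj A / of_real d"
      unfolding A' ep using A0 by (cases "d = 0") (auto simp: field_simps)
    also have "A * cnj A / of_real d = (\<Sum>s\<in>F. \<Sum>t\<in>F. c s * cnj (c t) * (k s p * k p t / of_real d))"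
      unfolding A'[symmetric] unfolding A_def sum_product sum_divide_distrib
      by (intro sum.cong refl) (auto simp: mult_ac)
    also have "(\<Sum>s\<in>F. \<Sum>t\<in>F. c s * cnj (c t) * k s t) - \<dots> = (\<Sum>s\<in>F. \<Sum>t\<in>F. c s * cnj (c t) * k' s t)"
      by (simp add: k'_def sum_subtractf right_diff_distrib)
    finally show "(\<Sum>s\<in>F. \<Sum>t\<in>F. c s * cnj (c t) * k' s t) \<in> \<real>\<^sub>\<ge>\<^sub>0"
      using psd_onD[OF insert.prems, of e] by simp
  qed
  from insert.IH[OF this] obtain v
    where v: "\<And>s t. s \<in> F \<Longrightarrow> t \<in> F \<Longrightarrow> k' s t = (\<Sum>q\<in>F. v q s * cnj (v q t))"
    by blast
  define w where
    "w q s = (if q = p then k s p / of_real (sqrt d) else if s = p then 0 else v q s)" for q s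
  have sq: "of_real (sqrt d) * of_real (sqrt d) = (of_real d :: complex)"
    using kpp by (simp flip: of_real_mult)
  have "k s t = (\<Sum>q\<in>insert p F. w q s * cnj (w q t))"
    if st: "s \<in> insert p F" "t \<in> insert p F" for s t
  proof -
    have "w p s * cnj (w p t) = k s p * k p t / of_real d"
      using herm[of t p] st by (simp add: w_def sq)
    moreover have "k s t - k s p * k p t / of_real d = (\<Sum>q\<in>F. w q s * cnj (w q t))"
    proof (cases "s = p \<or> t = p")
      case True
      have "k s t - k s p * k p t / of_real d = 0"
        using True zero[of s] zero[of t] herm[of t p] st kpp by (cases "d = 0") auto
      moreover have "(\<Sum>q\<in>F. w q s * cnj (w q t)) = 0"
        using True insert.hyps by (intro sum.neutral) (auto simp: w_def)
      ultimately show ?thesis by simp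
    next
      case False
      then have "(\<Sum>q\<in>F. w q s * cnj (w q t)) = (\<Sum>q\<in>F. v q s * cnj (v q t))"
        using insert.hyps by (intro sum.cong) (auto simp: w_def)
      then show ?thesis using v[of s t] st False by (simp add: k'_def)
    qed
    ultimately show ?thesis using insert.hyps by (simp add: algebra_simps)
  qed
  then show ?case by blast
qed

lemma nonneg_Reals_sum: "(\<And>i. i \<in> I \<Longrightarrow> f i \<in> \<real>\<^sub>\<ge>\<^sub>0) \<Longrightarrow> sum f I \<in> (\<real>\<^sub>\<ge>\<^sub>0 :: complex set)"
  by (induction I rule: infinite_finite_induct) (auto intro: nonneg_Reals_add_I)

lemma psd_on_mult:
  assumes "finite F" "psd_on F k" "psd_on F l"
  shows "psd_on F (\<lambda>s t. k s t * l s t)"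
  unfolding psd_on_def
proof
  fix c :: "'a \<Rightarrow> complex"
  obtain v where v: "\<And>s t. s \<in> F \<Longrightarrow> t \<in> F \<Longrightarrow> k s t = (\<Sum>p\<in>F. v p s * cnj (v p t))"
    using psd_on_gram[OF assms(1,2)] by blast
  have "(\<Sum>s\<in>F. \<Sum>t\<in>F. c s * cnj (c t) * (k s t * l s t))
      = (\<Sum>s\<in>F. \<Sum>t\<in>F. \<Sum>p\<in>F. (c s * v p s) * cnj (c t * v p t) * l s t)"
    by (intro sum.cong refl) (simp add: v sum_distrib_left sum_distrib_right mult_ac)
  also have "\<dots> = (\<Sum>s\<in>F. \<Sum>p\<in>F. \<Sum>t\<in>F. (c s * v p s) * cnj (c t * v p t) * l s t)"
    by (intro sum.cong refl sum.swap)
  also have "\<dots> = (\<Sum>p\<in>F. \<Sum>s\<in>F. \<Sum>t\<in>F. (c s * v p s) * cnj (c t * v p t) * l s t)"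
    by (rule sum.swap)
  also have "\<dots> \<in> \<real>\<^sub>\<ge>\<^sub>0"
    by (intro nonneg_Reals_sum psd_onD[OF assms(3)])
  finally show "(\<Sum>s\<in>F. \<Sum>t\<in>F. c s * cnj (c t) * (k s t * l s t)) \<in> \<real>\<^sub>\<ge>\<^sub>0" .
qed

lemma charactersD:
  assumes "\<phi> \<in> characters G"
  shows "g \<notin> carrier G \<Longrightarrow> \<phi> g = 0" "pos_def G \<phi>" "\<phi> \<one>\<^bsub>G\<^esub> = 1"
    "g \<in> carrier G \<Longrightarrow> h \<in> carrier G \<Longrightarrow> \<phi> (h \<otimes>\<^bsub>G\<^esub> g \<otimes>\<^bsub>G\<^esub> inv\<^bsub>G\<^esub> h) = \<phi> g"
  using assms by (auto simp: characters_def normalized_pos_def_def)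

lemma characters_mult:
  assumes "\<phi> \<in> characters G" "\<psi> \<in> characters G"
  shows "(\<lambda>g. \<phi> g * \<psi> g) \<in> characters G"
proof -
  have "pos_def G (\<lambda>g. \<phi> g * \<psi> g)"
    using charactersD(2)[OF assms(1)] charactersD(2)[OF assms(2)] psd_on_mult
    unfolding pos_def_iff_psd_on by blast
  then show ?thesis
    using assms by (simp add: characters_def normalized_pos_def_def)
qed

lemma (in group) character_inv:
  assumes "\<phi> \<in> characters G" "g \<in> carrier G"
  shows "\<phi> (inv g) = cnj (\<phi> g)"
proof -
  have "psd_on {\<one>, g} (\<lambda>s t. \<phi> (inv t \<otimes> s))"
    using charactersD(2)[OF assms(1)] assms(2) by (simp add: pos_def_iff_psd_on)
  from psd_on_hermitian[OF this, of g \<one>] show ?thesis using assms(2) by simp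
qed

lemma (in group) character_bound:
  assumes "\<phi> \<in> characters G"
  shows "cmod (\<phi> g) \<le> 1"
proof (cases "g \<in> carrier G \<and> g \<noteq> \<one>")
  case True
  then have "psd_on {\<one>, g} (\<lambda>s t. \<phi> (inv t \<otimes> s))"
    using charactersD(2)[OF assms(1)] by (simp add: pos_def_iff_psd_on)
  from psd_on_pair[OF this, of g \<one> 1 "- \<phi> g"] have "1 - (cmod (\<phi> g))\<^sup>2 \<ge> 0"
    using True charactersD(3)[OF assms] character_inv[OF assms, of g]
    unfolding cmod_power2 by (simp add: complex_nonneg_Reals_iff power2_eq_square)
  then show ?thesis by (simp add: abs_square_le_1)
qed (use charactersD(1,3)[OF assms] in auto)

lemma (in group) psd_on_character:
  assumes "\<phi> \<in> characters G" "finite F" "F \<subseteq> carrier G"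
  shows "psd_on F (\<lambda>s t. \<phi> (inv t \<otimes> s))"
  using charactersD(2)[OF assms(1)] assms(2,3) by (simp add: pos_def_iff_psd_on)

section \<open>Groups with infinite conjugacy classes\<close>

definition conj_class :: "('a, 'b) monoid_scheme \<Rightarrow> 'a \<Rightarrow> 'a set" where
  "conj_class G g = (\<lambda>x. x \<otimes>\<^bsub>G\<^esub> g \<otimes>\<^bsub>G\<^esub> inv\<^bsub>G\<^esub> x) ` carrier G"

definition icc :: "('a, 'b) monoid_scheme \<Rightarrow> bool" where
  "icc G \<longleftrightarrow> (\<forall>g\<in>carrier G. g \<noteq> \<one>\<^bsub>G\<^esub> \<longrightarrow> infinite (conj_class G g))"

lemma (in group) conj_class_subset: "g \<in> carrier G \<Longrightarrow> conj_class G g \<subseteq> carrier G"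
  by (auto simp: conj_class_def)

lemma (in group) one_notin_conj_class:
  assumes "g \<in> carrier G" "g \<noteq> \<one>"
  shows "\<one> \<notin> conj_class G g"
proof
  assume "\<one> \<in> conj_class G g"
  then obtain x where x: "x \<in> carrier G" "\<one> = x \<otimes> g \<otimes> inv x"
    by (auto simp: conj_class_def)
  have "x \<otimes> g = x"
    using x assms by (simp add: inv_solve_right)
  then show False using x assms by simp
qed

lemma (in group) character_vanishes_if_dominated_by_dirac:
  assumes \<phi>: "\<phi>\<^sub>1 \<in> characters G" "\<phi>\<^sub>2 \<in> characters G" and t: "0 < t" "t < 1"
    and eq: "dirac G = cscale (of_real t) \<phi>\<^sub>1 + cscale (of_real (1 - t)) \<phi>\<^sub>2"
    and g: "g \<in> carrier G" "infinite (conj_class G g)" "g \<noteq> \<one>"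
  shows "\<phi>\<^sub>1 g = 0"
proof -
  define \<alpha> where "\<alpha> = \<phi>\<^sub>1 g"
  have "real n * (t * (cmod \<alpha>)\<^sup>2) \<le> 1" for n
  proof (cases "n = 0")
    case False
    obtain F where F: "finite F" "card F = n" "F \<subseteq> conj_class G g"
      using infinite_arbitrarily_large[OF g(2)] by blast
    have FG: "F \<subseteq> carrier G" and 1: "\<one> \<notin> F"
      using F(3) conj_class_subset[OF g(1)] one_notin_conj_class[OF g(1,3)] by auto
    have val: "\<phi>\<^sub>1 s = \<alpha>" "\<phi>\<^sub>1 (inv s) = cnj \<alpha>" if "s \<in> F" for s
    proof -
      show "\<phi>\<^sub>1 s = \<alpha>"
        using that F(3) charactersD(4)[OF \<phi>(1) g(1)] by (auto simp: conj_class_def \<alpha>_def)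
      then show "\<phi>\<^sub>1 (inv s) = cnj \<alpha>"
        using character_inv[OF \<phi>(1)] that FG by auto
    qed
    define Q where "Q \<phi> = (\<Sum>s\<in>F. \<Sum>u\<in>F. \<phi> (inv u \<otimes> s))" for \<phi> :: "'a \<Rightarrow> complex"
    have "Q \<phi>\<^sub>2 \<in> \<real>\<^sub>\<ge>\<^sub>0"
      using psd_onD[OF psd_on_character[OF \<phi>(2) F(1) FG], of "\<lambda>_. 1"] by (simp add: Q_def)
    moreover have "of_real t * Q \<phi>\<^sub>1 + of_real (1 - t) * Q \<phi>\<^sub>2 = Q (dirac G)"
      unfolding Q_def eq by (simp add: cscale_def sum.distrib sum_distrib_left)
    moreover have "Q (dirac G) = of_nat n"
    proof -
      have "inv u \<otimes> s = \<one> \<longleftrightarrow> u = s" if "s \<in> F" "u \<in> F" for s u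
        using that FG inv_solve_left'[of \<one> u s] by auto
      then have "Q (dirac G) = (\<Sum>s\<in>F. \<Sum>u\<in>F. if u = s then 1 else 0)"
        unfolding Q_def dirac_def by (intro sum.cong refl) auto
      then show ?thesis using F by simp
    qed
    ultimately have "t * Re (Q \<phi>\<^sub>1) + (1 - t) * Re (Q \<phi>\<^sub>2) = n" "Re (Q \<phi>\<^sub>2) \<ge> 0"
      by (auto simp: complex_nonneg_Reals_iff complex_eq_iff)
    then have upper: "t * Re (Q \<phi>\<^sub>1) \<le> n"
      using t by (smt (verit) mult_nonneg_nonneg)
    define c where "c s = (if s = \<one> then - (of_nat n * \<alpha>) else 1)" for s
    have c: "c s = 1" if "s \<in> F" for s using that 1 by (auto simp: c_def)
    have "(\<Sum>s\<in>insert \<one> F. \<Sum>u\<in>insert \<one> F. c s * cnj (c u) * \<phi>\<^sub>1 (inv u \<otimes> s))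
        = c \<one> * cnj (c \<one>) + c \<one> * (\<Sum>u\<in>F. \<phi>\<^sub>1 (inv u)) + (cnj (c \<one>) * (\<Sum>s\<in>F. \<phi>\<^sub>1 s) + Q \<phi>\<^sub>1)"
    proof -
      have *: "\<one> \<otimes> s = s" "inv s \<otimes> \<one> = inv s" if "s \<in> F" for s
        using that FG by auto
      show ?thesis
        using 1 F charactersD(3)[OF \<phi>(1)]
        by (simp add: sum.distrib c * Q_def sum_distrib_left)
    qed
    also have "\<dots> = Q \<phi>\<^sub>1 - of_real ((real n * cmod \<alpha>)\<^sup>2)"
    proof -
      have "complex_of_real (cmod \<alpha>) * complex_of_real (cmod \<alpha>) = \<alpha> * cnj \<alpha>"
        using complex_norm_square[of \<alpha>] by (simp add: power2_eq_square)
      then show ?thesis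
        using F(2) by (simp add: val c_def algebra_simps power2_eq_square)
    qed
    finally have "(real n * cmod \<alpha>)\<^sup>2 \<le> Re (Q \<phi>\<^sub>1)"
      using psd_onD[OF psd_on_character[OF \<phi>(1), of "insert \<one> F"], of c] F FG
      by (simp add: complex_nonneg_Reals_iff)
    then have "t * (real n * cmod \<alpha>)\<^sup>2 \<le> n"
      using upper t by (meson mult_left_mono order_trans less_imp_le)
    then have "real n * (real n * (t * (cmod \<alpha>)\<^sup>2)) \<le> real n * 1"
      by (simp add: power2_eq_square mult_ac)
    then show ?thesis using False by (subst (asm) mult_le_cancel_left_pos) auto
  qed auto
  then have "\<not> 0 < t * (cmod \<alpha>)\<^sup>2"
    by (metis reals_Archimedean3 not_le)
  then show ?thesis using t by (auto simp: \<alpha>_def zero_less_mult_iff)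
qed

lemma (in group) icc_imp_dirac_extremal:
  assumes "icc G" "\<phi>\<^sub>1 \<in> characters G" "\<phi>\<^sub>2 \<in> characters G" "0 < t" "t < 1"
    and eq: "dirac G = cscale (of_real t) \<phi>\<^sub>1 + cscale (of_real (1 - t)) \<phi>\<^sub>2"
  shows "\<phi>\<^sub>1 = dirac G"
proof
  fix g
  show "\<phi>\<^sub>1 g = dirac G g"
  proof (cases "g \<in> carrier G \<and> g \<noteq> \<one>")
    case True
    then have "infinite (conj_class G g)" using assms(1) by (simp add: icc_def)
    then have "\<phi>\<^sub>1 g = 0"
      using character_vanishes_if_dominated_by_dirac[OF assms(2-6)] True by blast
    then show ?thesis using True by (simp add: dirac_def)
  next
    case False
    then consider "g = \<one>" | "g \<notin> carrier G" by blast
    then show ?thesis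
    proof cases
      case 1
      then show ?thesis using charactersD(3)[OF assms(2)] by (simp add: dirac_def)
    next
      case 2
      then have "g \<noteq> \<one>" by auto
      then show ?thesis using charactersD(1)[OF assms(2) 2] by (simp add: dirac_def)
    qed
  qed
qed

section \<open>Extremal factors\<close>

lemma closed_characters: "closed (characters G)"
proof -
  let ?Q = "\<lambda>F c \<phi>. (\<Sum>s\<in>F. \<Sum>t\<in>F. c s * cnj (c t) * \<phi> (inv\<^bsub>G\<^esub> t \<otimes>\<^bsub>G\<^esub> s))"
  have "closed {\<phi> :: 'a \<Rightarrow> complex. ?Q F c \<phi> \<in> \<real>\<^sub>\<ge>\<^sub>0}" for F c
  proof -
    have "continuous_on UNIV (?Q F c)"
      by (intro continuous_intros continuous_on_product_coordinates)
    from closed_vimage[OF closed_nonneg_Reals_complex this] show ?thesis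
      by (simp add: vimage_def)
  qed
  moreover have "closed {\<phi> :: 'a \<Rightarrow> complex. \<phi> g = z}" for g z
    by (intro closed_Collect_eq continuous_on_product_coordinates continuous_on_const)
  moreover have "closed {\<phi> :: 'a \<Rightarrow> complex. \<phi> g = \<phi> h}" for g h
    by (intro closed_Collect_eq continuous_on_product_coordinates)
  moreover have "characters G =
     (\<Inter>g\<in>- carrier G. {\<phi>. \<phi> g = 0}) \<inter>
     (\<Inter>F\<in>{F. finite F \<and> F \<subseteq> carrier G}. \<Inter>c. {\<phi>. ?Q F c \<phi> \<in> \<real>\<^sub>\<ge>\<^sub>0}) \<inter>
     {\<phi>. \<phi> \<one>\<^bsub>G\<^esub> = 1} \<inter>
     (\<Inter>g\<in>carrier G. \<Inter>h\<in>carrier G. {\<phi>. \<phi> (h \<otimes>\<^bsub>G\<^esub> g \<otimes>\<^bsub>G\<^esub> inv\<^bsub>G\<^esub> h) = \<phi> g})"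
    unfolding characters_def normalized_pos_def_def pos_def_def by blast
  ultimately show ?thesis
    by (simp only:) (intro closed_Int closed_INT ballI; simp)
qed

lemma (in group) compact_characters: "compact (characters G)"
proof -
  have "characters G = PiE UNIV (\<lambda>_. cball 0 1) \<inter> characters G"
    using character_bound by auto
  also have "compact \<dots>"
    by (intro compact_Int_closed compact_PiE_UNIV closed_characters compact_cball)
  finally show ?thesis .
qed

text \<open>The extreme point maximises the strictly convex function
  \<open>\<phi> \<mapsto> \<Sum>g. w g * |\<phi> g|\<^sup>2\<close> for summable positive weights \<open>w\<close>.\<close>

lemma ex_extreme_point:
  fixes K :: "('a \<Rightarrow> complex) set"
  assumes X: "countable X" and K: "compact K" and bound: "\<And>\<phi> g. \<phi> \<in> K \<Longrightarrow> cmod (\<phi> g) \<le> 1"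
    and supp: "\<And>\<phi> g. \<phi> \<in> K \<Longrightarrow> g \<notin> X \<Longrightarrow> \<phi> g = 0" and \<phi>\<^sub>0: "\<phi>\<^sub>0 \<in> K"
  obtains \<omega> where "\<omega> \<in> K"
    "(\<exists>g\<in>X. cmod (\<phi>\<^sub>0 g) < cmod (\<omega> g)) \<or> (\<forall>g\<in>X. cmod (\<phi>\<^sub>0 g) = cmod (\<omega> g))"
    "\<And>\<phi>\<^sub>1 \<phi>\<^sub>2 t. \<phi>\<^sub>1 \<in> K \<Longrightarrow> \<phi>\<^sub>2 \<in> K \<Longrightarrow> 0 < t \<Longrightarrow> t < 1 \<Longrightarrow>
       \<omega> = cscale (of_real t) \<phi>\<^sub>1 + cscale (of_real (1 - t)) \<phi>\<^sub>2 \<Longrightarrow> \<phi>\<^sub>1 = \<omega> \<and> \<phi>\<^sub>2 = \<omega>"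
proof -
  define w :: "'a \<Rightarrow> real" where "w g = (1 / 2) ^ to_nat_on X g" for g
  have wpos: "w g > 0" for g by (simp add: w_def)
  have wsum: "w summable_on X"
  proof -
    have "(\<lambda>n. (1 / 2 :: real) ^ n) summable_on UNIV"
      by (rule norm_summable_imp_summable_on) (simp add: summable_geometric)
    then have "(\<lambda>n. (1 / 2 :: real) ^ n) summable_on to_nat_on X ` X"
      by (rule summable_on_subset_banach) simp
    then show ?thesis
      using inj_on_to_nat_on[OF X] by (subst (asm) summable_on_reindex) (auto simp: o_def w_def[abs_def])
  qed
  define h where "h \<phi> = (\<Sum>\<^sub>\<infinity>g\<in>X. w g * (cmod (\<phi> g))\<^sup>2)" for \<phi> :: "'a \<Rightarrow> complex"
  have hsum: "(\<lambda>g. w g * (cmod (\<phi> g))\<^sup>2) summable_on X" if "\<And>g. cmod (\<phi> g) \<le> B" for \<phi> B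
  proof (rule summable_on_comparison_test[where f = "\<lambda>g. w g * B\<^sup>2"])
    show "(\<lambda>g. w g * B\<^sup>2) summable_on X"
      by (rule summable_on_cmult_left[OF wsum])
  qed (use that wpos in \<open>auto intro!: mult_left_mono power_mono simp: less_imp_le\<close>)
  have "uniform_limit K (\<lambda>F \<phi>. \<Sum>g\<in>F. w g * (cmod (\<phi> g))\<^sup>2) h (finite_subsets_at_top X)"
    unfolding h_def
  proof (rule Weierstrass_m_test_general[OF _ wsum])
    fix g \<phi> assume "g \<in> X" "\<phi> \<in> K"
    then show "norm (w g * (cmod (\<phi> g))\<^sup>2) \<le> w g"
      using bound[of \<phi> g] wpos[of g] by (simp add: power_le_one)
  qed
  then have "continuous_on K h"
    by (rule uniform_limit_theorem[rotated])
      (auto intro!: always_eventually continuous_intros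
          continuous_on_subset[OF continuous_on_product_coordinates])
  then obtain \<omega> where \<omega>: "\<omega> \<in> K" "\<And>\<phi>. \<phi> \<in> K \<Longrightarrow> h \<phi> \<le> h \<omega>"
    using continuous_attains_sup[OF K] \<phi>\<^sub>0 by blast
  show thesis
  proof (rule that[OF \<omega>(1)])
    have "\<forall>g\<in>X. cmod (\<phi>\<^sub>0 g) = cmod (\<omega> g)" if le: "\<forall>g\<in>X. cmod (\<omega> g) \<le> cmod (\<phi>\<^sub>0 g)"
    proof
      fix g assume g: "g \<in> X"
      let ?d = "\<lambda>g. w g * (cmod (\<phi>\<^sub>0 g))\<^sup>2 + - (w g * (cmod (\<omega> g))\<^sup>2)"
      have sums: "(\<lambda>g. w g * (cmod (\<phi>\<^sub>0 g))\<^sup>2) summable_on X" "(\<lambda>g. w g * (cmod (\<omega> g))\<^sup>2) summable_on X"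
        by (rule hsum[OF bound[OF \<phi>\<^sub>0]], rule hsum[OF bound[OF \<omega>(1)]])
      have "?d g = 0"
      proof (rule nonneg_infsum_le_0D[where A = X and f = ?d])
        show "infsum ?d X \<le> 0"
          using \<omega>(2)[OF \<phi>\<^sub>0] unfolding h_def
          by (subst infsum_add[OF sums(1) summable_on_uminus[THEN iffD2, OF sums(2)]]) (simp add: infsum_uminus)
        show "?d summable_on X" by (rule summable_on_add[OF sums(1) summable_on_uminus[THEN iffD2, OF sums(2)]])
        show "?d g \<ge> 0" if "g \<in> X" for g
          using le that wpos[of g] by (simp add: power_mono less_imp_le)
      qed (rule g)
      then show "cmod (\<phi>\<^sub>0 g) = cmod (\<omega> g)"
        using wpos[of g] by (auto simp flip: right_diff_distrib)
    qed
    then show "(\<exists>g\<in>X. cmod (\<phi>\<^sub>0 g) < cmod (\<omega> g)) \<or> (\<forall>g\<in>X. cmod (\<phi>\<^sub>0 g) = cmod (\<omega> g))"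
      by force
  next
    fix \<phi>\<^sub>1 \<phi>\<^sub>2 and t :: real
    assume \<phi>: "\<phi>\<^sub>1 \<in> K" "\<phi>\<^sub>2 \<in> K" and t: "0 < t" "t < 1"
      and eq: "\<omega> = cscale (of_real t) \<phi>\<^sub>1 + cscale (of_real (1 - t)) \<phi>\<^sub>2"
    have bound2: "cmod (\<phi>\<^sub>1 g - \<phi>\<^sub>2 g) \<le> 2" for g
      using norm_triangle_ineq4[of "\<phi>\<^sub>1 g" "\<phi>\<^sub>2 g"] bound[OF \<phi>(1), of g] bound[OF \<phi>(2), of g] by simp
    define D where "D = (\<Sum>\<^sub>\<infinity>g\<in>X. w g * (cmod (\<phi>\<^sub>1 g - \<phi>\<^sub>2 g))\<^sup>2)"
    have "w g * (cmod (\<omega> g))\<^sup>2 + t * (1 - t) * (w g * (cmod (\<phi>\<^sub>1 g - \<phi>\<^sub>2 g))\<^sup>2)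
        = t * (w g * (cmod (\<phi>\<^sub>1 g))\<^sup>2) + (1 - t) * (w g * (cmod (\<phi>\<^sub>2 g))\<^sup>2)" for g
      unfolding eq cmod_power2 by (simp add: cscale_def) (simp add: power2_eq_square algebra_simps)
    then have "(\<Sum>\<^sub>\<infinity>g\<in>X. w g * (cmod (\<omega> g))\<^sup>2 + t * (1 - t) * (w g * (cmod (\<phi>\<^sub>1 g - \<phi>\<^sub>2 g))\<^sup>2))
        = (\<Sum>\<^sub>\<infinity>g\<in>X. t * (w g * (cmod (\<phi>\<^sub>1 g))\<^sup>2) + (1 - t) * (w g * (cmod (\<phi>\<^sub>2 g))\<^sup>2))"
      by simp
    then have "h \<omega> + t * (1 - t) * D = t * h \<phi>\<^sub>1 + (1 - t) * h \<phi>\<^sub>2"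
      using hsum[OF bound[OF \<omega>(1)]] hsum[OF bound[OF \<phi>(1)]] hsum[OF bound[OF \<phi>(2)]]
        hsum[of "\<lambda>g. \<phi>\<^sub>1 g - \<phi>\<^sub>2 g", OF bound2]
      unfolding h_def D_def
      by (simp add: infsum_add infsum_cmult_right' summable_on_cmult_right)
    also have "\<dots> \<le> t * h \<omega> + (1 - t) * h \<omega>"
      using \<omega>(2)[OF \<phi>(1)] \<omega>(2)[OF \<phi>(2)] t by (intro add_mono mult_left_mono) auto
    finally have "t * (1 - t) * D \<le> 0" by (simp add: algebra_simps)
    then have D: "D \<le> 0" using t by (simp add: mult_le_0_iff)
    have "\<phi>\<^sub>1 g = \<phi>\<^sub>2 g" for g
    proof (cases "g \<in> X")
      case True
      have "(\<Sum>g\<in>{g}. w g * (cmod (\<phi>\<^sub>1 g - \<phi>\<^sub>2 g))\<^sup>2) \<le> D"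
        unfolding D_def using True wpos
        by (intro finite_sum_le_infsum hsum[OF bound2]) (auto simp: less_imp_le)
      then have "w g * (cmod (\<phi>\<^sub>1 g - \<phi>\<^sub>2 g))\<^sup>2 \<le> 0" using D by simp
      then show ?thesis using wpos[of g] by (simp add: mult_le_0_iff)
    qed (use supp[OF \<phi>(1)] supp[OF \<phi>(2)] in simp)
    then show "\<phi>\<^sub>1 = \<omega> \<and> \<phi>\<^sub>2 = \<omega>"
      unfolding eq by (auto simp: fun_eq_iff cscale_def algebra_simps)
  qed
qed

text \<open>The characters \<open>\<phi>\<close> with \<open>\<phi> \<psi> = \<delta>\<^sub>e\<close> form a face of the set of all characters: products of
  characters are characters, and \<open>\<delta>\<^sub>e\<close> is extremal.\<close>

lemma (in group) ex_extremal_factor: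
  assumes "countable (carrier G)" "icc G" and \<phi>: "\<phi> \<in> characters G" "\<phi> \<noteq> dirac G"
    and \<psi>: "\<psi> \<in> characters G" and fact: "\<forall>s\<in>carrier G. s \<noteq> \<one> \<longrightarrow> \<phi> s * \<psi> s = 0"
  obtains \<omega> where "extremal_character G \<omega>" "\<omega> \<noteq> dirac G"
    "\<forall>s\<in>carrier G. s \<noteq> \<one> \<longrightarrow> \<omega> s * \<psi> s = 0"
proof -
  define K where "K = {\<omega> \<in> characters G. \<forall>s\<in>carrier G. s \<noteq> \<one> \<longrightarrow> \<omega> s * \<psi> s = 0}"
  have "K = characters G \<inter> (\<Inter>s\<in>{s\<in>carrier G. s \<noteq> \<one>}. {\<omega>. \<omega> s * \<psi> s = 0})"
    by (auto simp: K_def)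
  also have "compact \<dots>"
    by (intro compact_Int_closed compact_characters closed_INT ballI closed_Collect_eq
        continuous_intros continuous_on_product_coordinates)
  finally have "compact K" .
  moreover have KD: "\<omega> \<in> characters G" if "\<omega> \<in> K" for \<omega> using that by (simp add: K_def)
  moreover have "\<phi> \<in> K" using \<phi> fact by (simp add: K_def)
  ultimately obtain \<omega> where \<omega>: "\<omega> \<in> K"
    "(\<exists>g\<in>carrier G. cmod (\<phi> g) < cmod (\<omega> g)) \<or> (\<forall>g\<in>carrier G. cmod (\<phi> g) = cmod (\<omega> g))"
    "\<And>\<phi>\<^sub>1 \<phi>\<^sub>2 t. \<phi>\<^sub>1 \<in> K \<Longrightarrow> \<phi>\<^sub>2 \<in> K \<Longrightarrow> 0 < t \<Longrightarrow> t < 1 \<Longrightarrow>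
       \<omega> = cscale (of_real t) \<phi>\<^sub>1 + cscale (of_real (1 - t)) \<phi>\<^sub>2 \<Longrightarrow> \<phi>\<^sub>1 = \<omega> \<and> \<phi>\<^sub>2 = \<omega>"
    using ex_extreme_point[OF assms(1), of K \<phi>] character_bound charactersD(1) by metis
  have mult_dirac: "(\<lambda>g. \<omega>' g * \<psi> g) = dirac G \<longleftrightarrow> \<omega>' \<in> K" if "\<omega>' \<in> characters G" for \<omega>'
    using charactersD(1,3)[OF that] charactersD(1,3)[OF \<psi>] that
    by (auto simp: K_def dirac_def fun_eq_iff)
  have face: "\<phi>\<^sub>1 \<in> K"
    if "\<phi>\<^sub>1 \<in> characters G" "\<phi>\<^sub>2 \<in> characters G" "0 < t" "t < 1"
      "\<omega> = cscale (of_real t) \<phi>\<^sub>1 + cscale (of_real (1 - t)) \<phi>\<^sub>2" for \<phi>\<^sub>1 \<phi>\<^sub>2 t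
  proof -
    have "dirac G = (\<lambda>g. \<omega> g * \<psi> g)"
      using mult_dirac[OF KD[OF \<omega>(1)]] \<omega>(1) by simp
    also have "\<dots> = cscale (of_real t) (\<lambda>g. \<phi>\<^sub>1 g * \<psi> g) + cscale (of_real (1 - t)) (\<lambda>g. \<phi>\<^sub>2 g * \<psi> g)"
      unfolding that(5) by (simp add: fun_eq_iff cscale_def algebra_simps)
    finally show ?thesis
      using icc_imp_dirac_extremal[OF assms(2) characters_mult characters_mult] that(1-4) \<psi>
        mult_dirac by blast
  qed
  have "extremal_character G \<omega>"
    unfolding extremal_character_def
  proof (intro conjI ballI allI impI)
    fix \<phi>\<^sub>1 \<phi>\<^sub>2 and t :: real
    assume *: "\<phi>\<^sub>1 \<in> characters G" "\<phi>\<^sub>2 \<in> characters G" "0 < t" "t < 1"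
      and eq: "\<omega> = cscale (of_real t) \<phi>\<^sub>1 + cscale (of_real (1 - t)) \<phi>\<^sub>2"
    have eq': "\<omega> = cscale (of_real (1 - t)) \<phi>\<^sub>2 + cscale (of_real (1 - (1 - t))) \<phi>\<^sub>1"
      using eq by (simp add: add.commute)
    have "\<phi>\<^sub>1 \<in> K" "\<phi>\<^sub>2 \<in> K"
      using face[OF * eq] face[OF *(2,1) _ _ eq'] * by auto
    then show "\<phi>\<^sub>1 = \<omega>" "\<phi>\<^sub>2 = \<omega>"
      using \<omega>(3)[OF _ _ *(3,4) eq] by auto
  qed (use KD \<omega>(1) in simp)
  moreover have "\<omega> \<noteq> dirac G"
  proof
    assume \<omega>': "\<omega> = dirac G"
    have le: "cmod (\<omega> g) \<le> cmod (\<phi> g)" for g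
      using charactersD(3)[OF \<phi>(1)] by (auto simp: \<omega>' dirac_def)
    then have "\<forall>g\<in>carrier G. cmod (\<phi> g) = cmod (\<omega> g)"
      using \<omega>(2) by (meson not_le)
    then have "\<phi> g = dirac G g" for g
      using charactersD(1,3)[OF \<phi>(1)] by (cases "g \<in> carrier G") (auto simp: \<omega>' dirac_def)
    then show False using \<phi>(2) by blast
  qed
  ultimately show thesis
    using that \<omega>(1) by (simp add: K_def)
qed

lemma (in group) gns_eq_imp_character_eq_1:
  assumes "gns_triple G \<omega> (H, \<pi>) \<xi>" "\<omega> \<in> characters G"
    "g \<in> carrier G" "h \<in> carrier G" "\<pi> g = \<pi> h"
  shows "\<omega> (inv g \<otimes> h) = 1"
proof -
  have hom: "\<pi> (x \<otimes> y) = \<pi> x \<circ> \<pi> y" if "x \<in> carrier G" "y \<in> carrier G" for x y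
    using assms(1) that hom_mult[of \<pi> G "unitary_group H" x y]
    by (auto simp: gns_triple_def unitary_rep_def unitary_group_def)
  have "\<pi> (inv g \<otimes> h) = \<pi> (inv g \<otimes> g)"
    using assms(3-5) hom[of "inv g" h] hom[of "inv g" g] by simp
  then have "\<pi> (inv g \<otimes> h) = \<pi> \<one>" using assms by simp
  moreover have "inner2 (\<pi> x \<xi>) \<xi> = \<omega> x" if "x \<in> carrier G" for x
    using assms(1) that by (simp add: gns_triple_def)
  ultimately show ?thesis
    using charactersD(3)[OF assms(2)] assms(3,4) by (metis inv_closed m_closed one_closed)
qed

lemma (in group) icc_infinite:
  assumes "icc G" "g \<in> carrier G" "g \<noteq> \<one>"
  shows "infinite (carrier G)"
  using assms unfolding icc_def conj_class_def by blast

lemma (in group) extremal_imp_finite_image: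
  assumes "charfinite G" "amenable_radical G = {\<one>}" "extremal_character G \<omega>" "\<omega> \<noteq> dirac G"
    and "\<And>(H :: (nat \<Rightarrow> complex) set) \<pi>.
           unitary_rep G (H, \<pi>) \<Longrightarrow> finite_dim H \<Longrightarrow> finite (\<pi> ` carrier G)"
  obtains H \<pi> \<xi> where "gns_triple G \<omega> (H, \<pi>) \<xi>" "finite (\<pi> ` carrier G)"
proof -
  have \<omega>: "\<omega> \<in> characters G" using assms(3) by (simp add: extremal_character_def)
  have "\<not> (\<forall>g\<in>carrier G. g \<notin> amenable_radical G \<longrightarrow> \<omega> g = 0)"
  proof
    assume "\<forall>g\<in>carrier G. g \<notin> amenable_radical G \<longrightarrow> \<omega> g = 0"
    then have "\<omega> g = dirac G g" for g
      using charactersD(1,3)[OF \<omega>] assms(2) by (cases "g \<in> carrier G") (auto simp: dirac_def)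
    then show False using assms(4) by blast
  qed
  then have "vn_amenable_character G \<omega>"
    using assms(1,3) unfolding charfinite_def by blast
  then have "amenable_character G \<omega>"
    unfolding vn_amenable_character_def amenable_character_def by blast
  then have "finite_character G \<omega>"
    using assms(1,3) unfolding charfinite_def by blast
  then obtain H \<pi> \<xi> where gns: "gns_triple G \<omega> (H, \<pi>) \<xi>" "finite_dim H"
    unfolding finite_character_def by blast
  then have "unitary_rep G (H, \<pi>)" by (simp add: gns_triple_def)
  then show thesis using that gns assms(5) by blast
qed

lemma (in group) icc_charfinite_imp_non_factorizable:
  assumes "countable (carrier G)" "charfinite G" "amenable_radical G = {\<one>}" "icc G"
    and fin: "\<And>(H :: (nat \<Rightarrow> complex) set) \<pi>.
           unitary_rep G (H, \<pi>) \<Longrightarrow> finite_dim H \<Longrightarrow> finite (\<pi> ` carrier G)"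
  shows "non_factorizable_regular_character G"
  unfolding non_factorizable_regular_character_def
proof (intro ballI impI; rule ccontr)
  fix \<phi> \<psi>
  assume \<phi>: "\<phi> \<in> characters G" and \<psi>: "\<psi> \<in> characters G"
    and fact: "\<forall>s\<in>carrier G. s \<noteq> \<one> \<longrightarrow> \<phi> s * \<psi> s = 0"
    and "\<not> (\<phi> = dirac G \<or> \<psi> = dirac G)"
  then have ne: "\<phi> \<noteq> dirac G" "\<psi> \<noteq> dirac G" by auto
  obtain g where "\<phi> g \<noteq> dirac G g" using ne(1) by blast
  then have "g \<in> carrier G" "g \<noteq> \<one>"
    using charactersD(1,3)[OF \<phi>] by (auto simp: dirac_def split: if_splits)
  then have inf: "infinite (carrier G)"
    using icc_infinite[OF assms(4)] by blast
  obtain \<omega> where \<omega>: "extremal_character G \<omega>" "\<omega> \<noteq> dirac G"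
    "\<forall>s\<in>carrier G. s \<noteq> \<one> \<longrightarrow> \<omega> s * \<psi> s = 0"
    by (rule ex_extremal_factor[OF assms(1,4) \<phi> ne(1) \<psi> fact])
  then have \<omega>c: "\<omega> \<in> characters G" by (simp add: extremal_character_def)
  obtain \<omega>' where \<omega>': "extremal_character G \<omega>'" "\<omega>' \<noteq> dirac G"
    "\<forall>s\<in>carrier G. s \<noteq> \<one> \<longrightarrow> \<omega>' s * \<omega> s = 0"
    by (rule ex_extremal_factor[OF assms(1,4) \<psi> ne(2) \<omega>c]) (use \<omega>(3) in \<open>auto simp: mult.commute\<close>)
  then have \<omega>c': "\<omega>' \<in> characters G" by (simp add: extremal_character_def)
  obtain H \<pi> \<xi> where gns: "gns_triple G \<omega> (H, \<pi>) \<xi>" "finite (\<pi> ` carrier G)"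
    by (rule extremal_imp_finite_image[OF assms(2,3) \<omega>(1,2) fin])
  obtain H' \<pi>' \<xi>' where gns': "gns_triple G \<omega>' (H', \<pi>') \<xi>'" "finite (\<pi>' ` carrier G)"
    by (rule extremal_imp_finite_image[OF assms(2,3) \<omega>'(1,2) fin])
  have "finite ((\<lambda>g. (\<pi> g, \<pi>' g)) ` carrier G)"
    by (rule finite_subset[OF _ finite_cartesian_product[OF gns(2) gns'(2)]]) auto
  then have "\<not> inj_on (\<lambda>g. (\<pi> g, \<pi>' g)) (carrier G)"
    using inf finite_imageD by blast
  then obtain g h where gh: "g \<in> carrier G" "h \<in> carrier G" "g \<noteq> h" "\<pi> g = \<pi> h" "\<pi>' g = \<pi>' h"
    by (auto simp: inj_on_def)
  have "inv g \<otimes> h \<noteq> \<one>"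
    using gh inv_solve_left'[of \<one> g h] by auto
  then have "\<omega>' (inv g \<otimes> h) * \<omega> (inv g \<otimes> h) = 0" using \<omega>'(3) gh by simp
  then show False
    using gns_eq_imp_character_eq_1[OF gns(1) \<omega>c gh(1,2,4)]
      gns_eq_imp_character_eq_1[OF gns'(1) \<omega>c' gh(1,2,5)] by simp
qed

text \<open>The subgroup \<open>N\<close> generated by a finite conjugacy class \<open>C\<close> is trivial: its centre is normal in
  \<open>G\<close> and abelian, hence trivial, so that the conjugation action of \<open>N\<close> on \<open>C\<close> is faithful and \<open>N\<close>
  is finite.\<close>

lemma (in group) trivial_radical_imp_icc:
  assumes rad: "amenable_radical G = {\<one>}"
  shows "icc G"
  unfolding icc_def
proof (intro ballI impI notI)
  fix g assume g: "g \<in> carrier G" "g \<noteq> \<one>" and finC: "finite (conj_class G g)"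
  let ?C = "conj_class G g"
  define N where "N = generate G ?C"
  have C: "?C \<subseteq> carrier G" by (rule conj_class_subset[OF g(1)])
  have gC: "g \<in> ?C"
    unfolding conj_class_def by (rule image_eqI[of _ _ \<one>]) (use g in auto)
  have conjC: "x \<otimes> c \<otimes> inv x \<in> ?C" if xc: "x \<in> carrier G" "c \<in> ?C" for x c
  proof -
    obtain y where y: "y \<in> carrier G" "c = y \<otimes> g \<otimes> inv y"
      using xc(2) by (auto simp: conj_class_def)
    have "x \<otimes> c \<otimes> inv x = (x \<otimes> y) \<otimes> g \<otimes> inv (x \<otimes> y)"
      using xc(1) y g by (simp add: m_assoc inv_mult_group)
    then show ?thesis using xc(1) y(1) by (auto simp: conj_class_def)
  qed
  have N: "N \<lhd> G" unfolding N_def by (rule normal_generateI[OF C conjC])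
  then have subN: "subgroup N G" by (rule normal_imp_subgroup)
  have NG: "N \<subseteq> carrier G" by (rule subgroup.subset[OF subN])
  define Z where "Z = {z\<in>N. \<forall>c\<in>?C. z \<otimes> c = c \<otimes> z}"
  have ZG: "Z \<subseteq> carrier G" using NG by (auto simp: Z_def)
  have centr: "z \<otimes> c = c \<otimes> z \<longleftrightarrow> z \<otimes> c \<otimes> inv z = c" if "z \<in> carrier G" "c \<in> carrier G" for z c
    using that inv_solve_right'[of c "z \<otimes> c" z] by auto
  have subZ: "subgroup Z G"
  proof (rule subgroupI[OF ZG])
    have "\<one> \<in> Z" using subgroup.one_closed[OF subN] C by (auto simp: Z_def subset_iff)
    then show "Z \<noteq> {}" by blast
  next
    fix z assume z: "z \<in> Z"
    then have zG: "z \<in> carrier G" using ZG by blast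
    have "inv z \<otimes> c = c \<otimes> inv z" if c: "c \<in> ?C" for c
    proof -
      have cG: "c \<in> carrier G" using c C by blast
      have "c = z \<otimes> c \<otimes> inv z" using z c centr[OF zG cG] by (simp add: Z_def)
      then have "inv z \<otimes> c = inv z \<otimes> (z \<otimes> c \<otimes> inv z)" by simp
      also have "\<dots> = c \<otimes> inv z" using zG cG by (simp add: m_assoc[symmetric])
      finally show ?thesis .
    qed
    then show "inv z \<in> Z" using z subgroup.m_inv_closed[OF subN] by (simp add: Z_def)
  next
    fix y z assume yz: "y \<in> Z" "z \<in> Z"
    have "y \<otimes> z \<otimes> c = c \<otimes> (y \<otimes> z)" if c: "c \<in> ?C" for c
    proof -
      have G: "y \<in> carrier G" "z \<in> carrier G" "c \<in> carrier G" using yz c ZG C by auto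
      have "y \<otimes> z \<otimes> c = y \<otimes> (c \<otimes> z)" using yz c G by (simp add: Z_def m_assoc)
      also have "\<dots> = y \<otimes> c \<otimes> z" using G by (simp add: m_assoc)
      also have "\<dots> = c \<otimes> (y \<otimes> z)" using yz c G by (simp add: Z_def m_assoc)
      finally show ?thesis .
    qed
    then show "y \<otimes> z \<in> Z" using yz subgroup.m_closed[OF subN] by (simp add: Z_def)
  qed
  have "Z \<lhd> G"
  proof (rule normal_invI[OF subZ])
    fix x z assume x: "x \<in> carrier G" and z: "z \<in> Z"
    have zG: "z \<in> carrier G" using z ZG by blast
    have "x \<otimes> z \<otimes> inv x \<otimes> c = c \<otimes> (x \<otimes> z \<otimes> inv x)" if c: "c \<in> ?C" for c
    proof -
      have cG: "c \<in> carrier G" using c C by blast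
      have "inv x \<otimes> c \<otimes> x \<in> ?C" using conjC[of "inv x" c] x c by simp
      then have "z \<otimes> (inv x \<otimes> c \<otimes> x) = (inv x \<otimes> c \<otimes> x) \<otimes> z" using z by (simp add: Z_def)
      then have "x \<otimes> (z \<otimes> (inv x \<otimes> c \<otimes> x)) \<otimes> inv x = x \<otimes> ((inv x \<otimes> c \<otimes> x) \<otimes> z) \<otimes> inv x" by simp
      moreover have "x \<otimes> (z \<otimes> (inv x \<otimes> c \<otimes> x)) \<otimes> inv x = x \<otimes> z \<otimes> inv x \<otimes> c"
        using x zG cG by (simp add: m_assoc)
      moreover have "x \<otimes> ((inv x \<otimes> c \<otimes> x) \<otimes> z) \<otimes> inv x = c \<otimes> (x \<otimes> z \<otimes> inv x)"
      proof -
        have "x \<otimes> ((inv x \<otimes> c \<otimes> x) \<otimes> z) \<otimes> inv x = (x \<otimes> inv x) \<otimes> (c \<otimes> (x \<otimes> (z \<otimes> inv x)))"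
          using x zG cG by (simp only: m_assoc m_closed inv_closed)
        then show ?thesis using x zG cG by (simp add: m_assoc)
      qed
      ultimately show ?thesis by simp
    qed
    then show "x \<otimes> z \<otimes> inv x \<in> Z"
      using z normal_conj_closed(1)[OF N x] by (simp add: Z_def)
  qed
  moreover have "amenable_group (G\<lparr>carrier := Z\<rparr>)"
  proof (rule comm_group.amenable)
    have comm: "z \<otimes> n = n \<otimes> z" if z: "z \<in> Z" and n: "n \<in> N" for z n
    proof -
      have zG: "z \<in> carrier G" using z ZG by blast
      show ?thesis
        using n unfolding N_def
      proof induction
        case one
        then show ?case using zG by simp
      next
        case (incl c)
        then show ?case using z by (simp add: Z_def)
      next
        case (inv c)
        then have cG: "c \<in> carrier G" using C by blast
        have "z \<otimes> c = c \<otimes> z" using z inv by (simp add: Z_def)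
        then have "inv c \<otimes> (z \<otimes> c) \<otimes> inv c = inv c \<otimes> (c \<otimes> z) \<otimes> inv c" by simp
        moreover have "inv c \<otimes> (z \<otimes> c) \<otimes> inv c = inv c \<otimes> z"
          using zG cG by (simp add: m_assoc)
        moreover have "inv c \<otimes> (c \<otimes> z) \<otimes> inv c = z \<otimes> inv c"
          using zG cG by (simp add: m_assoc[symmetric])
        ultimately show ?case by simp
      next
        case (eng a b)
        then have G: "a \<in> carrier G" "b \<in> carrier G" using generate_incl[OF C] by auto
        have "z \<otimes> (a \<otimes> b) = a \<otimes> z \<otimes> b" using eng.IH(1) G zG by (simp add: m_assoc[symmetric])
        also have "\<dots> = a \<otimes> b \<otimes> z" using eng.IH(2) G zG by (simp add: m_assoc)
        finally show ?case .
      qed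
    qed
    show "comm_group (G\<lparr>carrier := Z\<rparr>)"
    proof (rule group.group_comm_groupI[OF subgroup_imp_group[OF subZ]])
      fix x y assume "x \<in> carrier (G\<lparr>carrier := Z\<rparr>)" "y \<in> carrier (G\<lparr>carrier := Z\<rparr>)"
      then have "x \<in> Z" "y \<in> N" by (auto simp: Z_def)
      then show "x \<otimes>\<^bsub>G\<lparr>carrier := Z\<rparr>\<^esub> y = y \<otimes>\<^bsub>G\<lparr>carrier := Z\<rparr>\<^esub> x"
        using comm[of x y] by simp
    qed
  qed
  ultimately have Z1: "Z \<subseteq> {\<one>}" using amenable_normal_le_radical rad by blast
  have "inj_on (\<lambda>n. restrict (\<lambda>c. n \<otimes> c \<otimes> inv n) ?C) N"
  proof (rule inj_onI)
    fix m n assume mn: "m \<in> N" "n \<in> N"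
      and eq: "restrict (\<lambda>c. m \<otimes> c \<otimes> inv m) ?C = restrict (\<lambda>c. n \<otimes> c \<otimes> inv n) ?C"
    have G: "m \<in> carrier G" "n \<in> carrier G" using mn NG by auto
    have "inv n \<otimes> m \<otimes> c = c \<otimes> (inv n \<otimes> m)" if c: "c \<in> ?C" for c
    proof -
      have cG: "c \<in> carrier G" using c C by blast
      have "m \<otimes> c \<otimes> inv m = n \<otimes> c \<otimes> inv n"
        using fun_cong[OF eq, of c] c by simp
      then have "inv n \<otimes> (m \<otimes> c \<otimes> inv m) \<otimes> m = inv n \<otimes> (n \<otimes> c \<otimes> inv n) \<otimes> m" by simp
      moreover have "inv n \<otimes> (m \<otimes> c \<otimes> inv m) \<otimes> m = inv n \<otimes> m \<otimes> c"
        using G cG by (simp add: m_assoc)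
      moreover have "inv n \<otimes> (n \<otimes> c \<otimes> inv n) \<otimes> m = (inv n \<otimes> n) \<otimes> (c \<otimes> (inv n \<otimes> m))"
        using G cG by (simp only: m_assoc m_closed inv_closed)
      ultimately show ?thesis using G cG by simp
    qed
    then have "inv n \<otimes> m \<in> Z"
      using mn subN by (simp add: Z_def subgroup.m_closed subgroup.m_inv_closed)
    then show "m = n" using Z1 G inv_solve_left'[of \<one> n m] by auto
  qed
  moreover have "(\<lambda>n. restrict (\<lambda>c. n \<otimes> c \<otimes> inv n) ?C) ` N \<subseteq> PiE ?C (\<lambda>_. ?C)"
    using conjC NG by auto
  moreover have "finite (PiE ?C (\<lambda>_. ?C))" using finC by (intro finite_PiE)
  ultimately have "finite N" using inj_on_finite by blast
  then have "amenable_group (G\<lparr>carrier := N\<rparr>)"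
    using group.finite_imp_amenable[OF subgroup_imp_group[OF subN]] by simp
  then have "N \<subseteq> {\<one>}" using amenable_normal_le_radical[OF N] rad by simp
  moreover have "g \<in> N" unfolding N_def by (rule generate.incl[OF gC])
  ultimately show False using g(2) by blast
qed

theorem proposition3p17:
  fixes G (structure)
  assumes "group G" and "countable (carrier G)"
    and "charfinite G"
    and "amenable_radical G = {\<one>}"
    and "\<And>(H :: (nat \<Rightarrow> complex) set) \<pi>.
           unitary_rep G (H, \<pi>) \<Longrightarrow> finite_dim H \<Longrightarrow> finite (\<pi> ` carrier G)"
  shows "non_factorizable_regular_character G"
  by (rule group.icc_charfinite_imp_non_factorizable[OF assms(1-4)
        group.trivial_radical_imp_icc[OF assms(1,4)] assms(5)])

end
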